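(* Let $\mathbf{H}$ be a closed subspace of $\mathbf{H}_2(\Lambda_+)$. Then $\mathbf{H}$ is $Z$-invariant (i.e. $Z\mathbf{H}\subseteq\mathbf{H}$) if, and only if, there exists a discrete analytic Schur function $s$ such that the operator $M_sf=s\odot f$ is an isometry on $\mathbf{H}_2(\Lambda_+)$ with range $\mathbf{H}$.
   Context: Let $\Lambda=\mathbb{Z}+i\mathbb{Z}\subset\mathbb{C}$ and $\Lambda_+=\{z\in\Lambda:\operatorname{Re}(z)\ge 0\}$. A function $f$ on $\Lambda$ (respectively $\Lambda_+$) is discrete analytic if $$\frac{f(z+1+i)-f(z)}{1+i}=\frac{f(z+1)-f(z+i)}{1-i}$$ for all $z\in\Lambda$ (respectively $z\in\Lambda_+$). A path from $a$ to $b$ is a finite sequence $\gamma=(z_0,\ldots,z_n)$ of lattice points with $z_0=a$, $z_n=b$, $|z_k-z_{k-1}|=1$, and $\int_\gamma f\,\delta z=\sum_{k=1}^n\frac{f(z_{k-1})+f(z_k)}{2}(z_k-z_{k-1})$. For a discrete analytic $f$ this integral depends only on the endpoints (for $f$ defined on $\Lambda_+$, paths are taken in $\Lambda_+$). Define $$(Zf)(z)=\frac{f(0)-f(z)}{2}+\int_0^z f\,\delta z.$$ For $n\ge 0$, $z^{(n)}:=(Z^n1)(z)$, a discrete analytic polynomial of degree $n$. If $\limsup_n|\hat f(n)|^{1/n}<\sqrt2$, the series $\sum_n\hat f(n)z^{(n)}$ converges absolutely on $\Lambda_+$ to a discrete analytic function $f$ that determines the coefficients $\hat f(n)$ uniquely.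 The Hardy space $\mathbf{H}_2(\Lambda_+)$ is the Hilbert space of functions $f(z)=\sum_{n=0}^\infty\hat f(n)z^{(n)}$ on $\Lambda_+$ with $\sum_n|\hat f(n)|^2<\infty$, with inner product $\langle f,g\rangle=\sum_{n=0}^\infty\hat f(n)\overline{\hat g(n)}$. It is invariant under $Z$. A function $s$ discrete analytic on $\Lambda_+$ is called a discrete analytic Schur function if $$\sum_{n=0}^\infty|(Z^ns)(z)|^2<\infty\quad\text{for all }z\in\Lambda_+,$$ and the kernel $$K^s_w(z)=\sum_{n=0}^\infty\left(z^{(n)}\,\overline{w^{(n)}}-(Z^ns)(z)\,\overline{(Z^ns)(w)}\right)$$ is positive in $\Lambda_+$, i.e. $\sum_{j,k=1}^N c_j\overline{c_k}\,K^s_{w_k}(w_j)\ge 0$ for all $N\ge1$, $w_1,\ldots,w_N\in\Lambda_+$, $c_1,\ldots,c_N\in\mathbb{C}$. Every discrete analytic Schur function $s$ lies in $\mathbf{H}_2(\Lambda_+)$, and for $f\in\mathbf{H}_2(\Lambda_+)$ the convolution product $$(s\odot f)(z)=\sum_{n=0}^\infty\sum_{m=0}^n\hat s(m)\hat f(n-m)z^{(n)}$$ converges absolutely on $\Lambda_+$ and defines a contraction $M_s:f\mapsto s\odot f$ on $\mathbf{H}_2(\Lambda_+)$.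
   Formalization: The closed subspace H is assumed to be different from {0}; for H = {0} the claim fails, since {0} is closed and Z-invariant but no isometry on the nonzero space H_2(Λ_+) has range {0}. *)

theory Defs
  imports
    "HOL-Analysis.Analysis"
    "HOL-Library.Complex_Order"
    "HOL-Library.Function_Algebras"
begin

text \<open>
  The order on \<^typ>\<open>complex\<close> is that of \<^theory>\<open>HOL-Library.Complex_Order\<close>:
  \<open>0 \<le> c\<close> means that \<open>c\<close> is real and non-negative.
\<close>

definition half_lattice :: "complex set" where
  "half_lattice = {z. Re z \<in> \<int> \<and> Im z \<in> \<int> \<and> 0 \<le> Re z}"

text \<open>
  A function on \<^const>\<open>half_lattice\<close> is represented by a function on the complex plane
  that vanishes off the half lattice, so that equality of representatives is equality of functions
  on the half lattice.
\<close>

definition half_fun :: "(complex \<Rightarrow> complex) \<Rightarrow> bool" where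
  "half_fun f \<longleftrightarrow> (\<forall>z. z \<notin> half_lattice \<longrightarrow> f z = 0)"

definition discrete_analytic :: "(complex \<Rightarrow> complex) \<Rightarrow> bool" where
  "discrete_analytic f \<longleftrightarrow>
     (\<forall>z\<in>half_lattice.
        (f (z + 1 + \<i>) - f z) / (1 + \<i>) = (f (z + 1) - f (z + \<i>)) / (1 - \<i>))"

definition half_path :: "complex \<Rightarrow> complex \<Rightarrow> complex list \<Rightarrow> bool" where
  "half_path a b p \<longleftrightarrow>
     p \<noteq> [] \<and> hd p = a \<and> last p = b \<and> set p \<subseteq> half_lattice \<and>
     (\<forall>k. Suc k < length p \<longrightarrow> cmod (p ! Suc k - p ! k) = 1)"

definition path_sum :: "complex list \<Rightarrow> (complex \<Rightarrow> complex) \<Rightarrow> complex" where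
  "path_sum p f =
     (\<Sum>k<length p - 1. (f (p ! k) + f (p ! Suc k)) / 2 * (p ! Suc k - p ! k))"

text \<open>
  The common value of the sums along all paths; it exists when \<open>f\<close> is discrete analytic and
  \<open>a\<close>, \<open>b\<close> are in \<^const>\<open>half_lattice\<close>, and is unspecified if there is no common value.
\<close>

definition discrete_integral :: "complex \<Rightarrow> complex \<Rightarrow> (complex \<Rightarrow> complex) \<Rightarrow> complex" where
  "discrete_integral a b f = (THE c. \<forall>p. half_path a b p \<longrightarrow> path_sum p f = c)"

definition Zop :: "(complex \<Rightarrow> complex) \<Rightarrow> complex \<Rightarrow> complex" where
  "Zop f z =
     (if z \<in> half_lattice then (f 0 - f z) / 2 + discrete_integral 0 z f else 0)"

definition dpow :: "nat \<Rightarrow> complex \<Rightarrow> complex" where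
  "dpow n = (Zop ^^ n) (indicator half_lattice)"

definition h2_expansion :: "(complex \<Rightarrow> complex) \<Rightarrow> (nat \<Rightarrow> complex) \<Rightarrow> bool" where
  "h2_expansion f a \<longleftrightarrow>
     summable (\<lambda>n. (cmod (a n))\<^sup>2) \<and>
     (\<forall>z\<in>half_lattice. (\<lambda>n. a n * dpow n z) sums f z)"

definition H2 :: "(complex \<Rightarrow> complex) set" where
  "H2 = {f. half_fun f \<and> (\<exists>a. h2_expansion f a)}"

text \<open>
  The value \<open>0\<close> off \<^const>\<open>H2\<close> makes \<open>h2_dist\<close> below non-negative on all arguments, as
  \<^locale>\<open>Metric_space\<close> demands.
\<close>

definition h2_coeff :: "(complex \<Rightarrow> complex) \<Rightarrow> nat \<Rightarrow> complex" where
  "h2_coeff f n = (if f \<in> H2 then (THE a. h2_expansion f a) n else 0)"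

definition h2_inner :: "(complex \<Rightarrow> complex) \<Rightarrow> (complex \<Rightarrow> complex) \<Rightarrow> complex" where
  "h2_inner f g = (\<Sum>n. h2_coeff f n * cnj (h2_coeff g n))"

definition h2_norm :: "(complex \<Rightarrow> complex) \<Rightarrow> real" where
  "h2_norm f = sqrt (Re (h2_inner f f))"

definition h2_dist :: "(complex \<Rightarrow> complex) \<Rightarrow> (complex \<Rightarrow> complex) \<Rightarrow> real" where
  "h2_dist f g = h2_norm (\<lambda>z. f z - g z)"

definition closed_subspace_H2 :: "(complex \<Rightarrow> complex) set \<Rightarrow> bool" where
  "closed_subspace_H2 H \<longleftrightarrow>
     H \<subseteq> H2 \<and>
     module.subspace (\<lambda>c f z. c * f z) H \<and>
     closedin (Metric_space.mtopology H2 h2_dist) H"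

definition schur_kernel :: "(complex \<Rightarrow> complex) \<Rightarrow> complex \<Rightarrow> complex \<Rightarrow> complex" where
  "schur_kernel s w z =
     (\<Sum>n. dpow n z * cnj (dpow n w) - (Zop ^^ n) s z * cnj ((Zop ^^ n) s w))"

definition positive_kernel :: "(complex \<Rightarrow> complex \<Rightarrow> complex) \<Rightarrow> bool" where
  "positive_kernel K \<longleftrightarrow>
     (\<forall>N\<ge>1. \<forall>(w :: nat \<Rightarrow> complex) (c :: nat \<Rightarrow> complex).
        (\<forall>j\<in>{1..N}. w j \<in> half_lattice) \<longrightarrow>
        0 \<le> (\<Sum>j=1..N. \<Sum>k=1..N. c j * cnj (c k) * K (w k) (w j)))"

definition schur_function :: "(complex \<Rightarrow> complex) \<Rightarrow> bool" where
  "schur_function s \<longleftrightarrow>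
     half_fun s \<and> discrete_analytic s \<and>
     (\<forall>z\<in>half_lattice. summable (\<lambda>n. (cmod ((Zop ^^ n) s z))\<^sup>2)) \<and>
     positive_kernel (schur_kernel s)"

definition conv_prod ::
    "(complex \<Rightarrow> complex) \<Rightarrow> (complex \<Rightarrow> complex) \<Rightarrow> complex \<Rightarrow> complex" (infixl "\<odot>" 70) where
  "(s \<odot> f) z =
     (if z \<in> half_lattice
      then (\<Sum>n. (\<Sum>m\<le>n. h2_coeff s m * h2_coeff f (n - m) * dpow n z))
      else 0)"

definition isometry_on_H2 :: "((complex \<Rightarrow> complex) \<Rightarrow> complex \<Rightarrow> complex) \<Rightarrow> bool" where
  "isometry_on_H2 T \<longleftrightarrow> (\<forall>f\<in>H2. T f \<in> H2 \<and> h2_norm (T f) = h2_norm f)"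

end

theory Submission
  imports Defs
begin

text \<open>
  Everything is carried over to the space of square summable sequences. The expansion
  coefficients identify \<open>H\<^sub>2\<close> isometrically with that space
  (\<open>H2_eq_range\<close>, \<open>inj_h2_fun\<close>, \<open>h2_norm_h2_fun\<close>), \<open>Z\<close> becomes the unilateral shift
  \<open>S\<close> (\<open>Zop_h2_fun\<close>), and \<open>s \<odot> f\<close> becomes the Cauchy product of the coefficient sequences. The
  assertion is then Beurling's theorem for \<open>S\<close>, complemented by the fact that the
  functions \<open>s\<close> so obtained are discrete analytic Schur functions.

  \<^emph>\<open>The dictionary.\<close> A discrete analytic \<open>f\<close> has a primitive on the half lattice, and expressing
  \<open>Z f\<close> through it gives
  \<open>(Z f)(z + 1) = (Z f)(z) + f(z)\<close> and
  \<open>(Z f)(z + \<i>) = (Z f)(z) + ((1 + \<i>) f(z) + (\<i> - 1) f(z + \<i>)) / 2\<close>;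
  together with \<open>(Z f)(0) = 0\<close> this determines \<open>Z f\<close> (\<open>Z_recurrence_Zop\<close>,
  \<open>Z_recurrence_unique\<close>). These relations pass to convergent series, so no path
  is mentioned any more. They also show that \<open>z\<^sup>(\<^sup>n\<^sup>)\<close> is absolutely summable in \<open>n\<close> for each \<open>z\<close>
  (\<open>dpow_abs_summable\<close>) and that \<open>z\<^sup>(\<^sup>n\<^sup>)\<close> is the binomial coefficient \<open>z choose n\<close> at the natural
  numbers, so that the values of a series there determine its coefficients.

  \<^emph>\<open>Beurling's theorem\<close> (\<open>beurling\<close>). Let \<open>L \<noteq> {0}\<close> be closed and shift invariant, and let \<open>k\<close> be the
  least index at which some element of \<open>L\<close> does not vanish. Projecting such an element
  orthogonally to \<open>{a \<in> L. a\<^sub>k = 0}\<close>, which contains \<open>S L\<close>, gives a unit vector \<open>b \<in> L\<close> orthogonal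
  to \<open>S L\<close>; hence the vectors \<open>S\<^sup>n b\<close> are orthonormal and \<open>c \<mapsto> \<Sum>n. c\<^sub>n S\<^sup>n b\<close>, which is the
  Cauchy product with \<open>b\<close>, is an isometry into \<open>L\<close>. If its range were not all of \<open>L\<close>, its orthogonal
  complement in \<open>L\<close>, which is again closed and shift invariant, would contain a
  vector \<open>r\<close> such that all the \<open>S\<^sup>n b\<close> and \<open>S\<^sup>m r\<close> together are orthonormal. Bessel's inequality for the
  \<open>j\<close>-th unit vector then says
  \<open>(\<Sum>i\<le>j. \<bar>b\<^sub>i\<bar>\<^sup>2) + (\<Sum>i\<le>j. \<bar>r\<^sub>i\<bar>\<^sup>2) \<le> 1\<close>, and \<open>j \<rightarrow> \<infinity>\<close> gives the contradiction \<open>2 \<le> 1\<close>.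

  \<^emph>\<open>The Schur property\<close> (\<open>schur_function_h2_fun\<close>). Evaluation at \<open>z\<close> is the inner product with
  the vector \<open>k\<^sub>z\<close> whose entries are the conjugates of the \<open>z\<^sup>(\<^sup>n\<^sup>)\<close>. If \<open>s\<close> has coefficient sequence \<open>b\<close>
  and \<open>x\<close> is a linear combination of the \<open>k\<^sub>z\<close>, the quadratic form of the Schur kernel of \<open>s\<close> is
  \<open>\<parallel>x\<parallel>\<^sup>2 - (\<Sum>n. \<bar>\<langle>S\<^sup>n b, x\<rangle>\<bar>\<^sup>2)\<close>, non-negative by Bessel's inequality again.

  \<^emph>\<open>The converse\<close> is the identity \<open>Z (s \<odot> f) = s \<odot> (Z f)\<close> (\<open>Zop_conv_prod\<close>).
\<close>

section \<open>The Hilbert space of square summable sequences\<close>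

lemma square_summable_add:
  fixes a b :: "nat \<Rightarrow> complex"
  assumes "summable (\<lambda>n. (cmod (a n))\<^sup>2)" "summable (\<lambda>n. (cmod (b n))\<^sup>2)"
  shows "summable (\<lambda>n. (cmod (a n + b n))\<^sup>2)"
proof (rule summable_comparison_test')
  show "summable (\<lambda>n. 2 * (cmod (a n))\<^sup>2 + 2 * (cmod (b n))\<^sup>2)"
    using assms by (intro summable_add summable_mult)
  fix n :: nat
  have "(cmod (a n + b n))\<^sup>2 \<le> (cmod (a n) + cmod (b n))\<^sup>2"
    by (intro power_mono norm_triangle_ineq norm_ge_zero)
  also have "\<dots> \<le> 2 * (cmod (a n))\<^sup>2 + 2 * (cmod (b n))\<^sup>2"
    using sum_squares_bound[of "cmod (a n)" "cmod (b n)"] by (simp add: power2_sum)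
  finally show "norm ((cmod (a n + b n))\<^sup>2) \<le> 2 * (cmod (a n))\<^sup>2 + 2 * (cmod (b n))\<^sup>2"
    by simp
qed

lemma square_summable_mult:
  fixes a :: "nat \<Rightarrow> complex"
  assumes "summable (\<lambda>n. (cmod (a n))\<^sup>2)"
  shows "summable (\<lambda>n. (cmod (c * a n))\<^sup>2)"
  using assms by (auto simp: norm_mult power_mult_distrib intro: summable_mult)

lemma abs_summable_mult_cnj:
  fixes a b :: "nat \<Rightarrow> complex"
  assumes "summable (\<lambda>n. (cmod (a n))\<^sup>2)" "summable (\<lambda>n. (cmod (b n))\<^sup>2)"
  shows "summable (\<lambda>n. cmod (a n * cnj (b n)))"
proof (rule summable_comparison_test')
  show "summable (\<lambda>n. (cmod (a n))\<^sup>2 + (cmod (b n))\<^sup>2)"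
    using assms by (intro summable_add)
  fix n :: nat
  have "2 * (cmod (a n) * cmod (b n)) \<le> (cmod (a n))\<^sup>2 + (cmod (b n))\<^sup>2"
    using sum_squares_bound[of "cmod (a n)" "cmod (b n)"] by (simp add: mult.assoc)
  moreover have "norm (cmod (a n * cnj (b n))) = cmod (a n) * cmod (b n)"
    by (simp add: norm_mult)
  moreover have "0 \<le> cmod (a n) * cmod (b n)" by simp
  ultimately show "norm (cmod (a n * cnj (b n))) \<le> (cmod (a n))\<^sup>2 + (cmod (b n))\<^sup>2"
    by linarith
qed

text \<open>
  A type rather than a set of sequences, so that the library on real inner product spaces and
  on Banach spaces applies. The classes know
  the real inner product only; the complex one is kept beside it.
\<close>

typedef ell2 = "{a :: nat \<Rightarrow> complex. summable (\<lambda>n. (cmod (a n))\<^sup>2)}"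
  morphisms coef Ell2
  by (rule exI[of _ "\<lambda>_. 0"]) simp

setup_lifting type_definition_ell2

lemma coef_square_summable: "summable (\<lambda>n. (cmod (coef a n))\<^sup>2)"
  using coef[of a] by simp

lemma coef_Ell2: "summable (\<lambda>n. (cmod (a n))\<^sup>2) \<Longrightarrow> coef (Ell2 a) = a"
  by (simp add: Ell2_inverse)

lemma ell2_eqI: "(\<And>n. coef a n = coef b n) \<Longrightarrow> a = b"
  by (meson coef_inject ext)

lift_definition cscale :: "complex \<Rightarrow> ell2 \<Rightarrow> ell2" is "\<lambda>c a n. c * a n"
  by (rule square_summable_mult)

definition cinner :: "ell2 \<Rightarrow> ell2 \<Rightarrow> complex" where
  "cinner a b = (\<Sum>n. coef a n * cnj (coef b n))"

lemma cinner_abs_summable: "summable (\<lambda>n. cmod (coef a n * cnj (coef b n)))"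
  by (rule abs_summable_mult_cnj[OF coef_square_summable coef_square_summable])

lemma cinner_sums: "(\<lambda>n. coef a n * cnj (coef b n)) sums cinner a b"
  unfolding cinner_def by (rule summable_sums[OF summable_norm_cancel[OF cinner_abs_summable]])

instantiation ell2 :: real_vector
begin

lift_definition zero_ell2 :: ell2 is "\<lambda>_. 0" by simp
lift_definition plus_ell2 :: "ell2 \<Rightarrow> ell2 \<Rightarrow> ell2" is "\<lambda>a b n. a n + b n"
  by (rule square_summable_add)
lift_definition uminus_ell2 :: "ell2 \<Rightarrow> ell2" is "\<lambda>a n. - a n" by simp
lift_definition minus_ell2 :: "ell2 \<Rightarrow> ell2 \<Rightarrow> ell2" is "\<lambda>a b n. a n - b n"
proof -
  fix a b :: "nat \<Rightarrow> complex"
  assume "summable (\<lambda>n. (cmod (a n))\<^sup>2)" "summable (\<lambda>n. (cmod (b n))\<^sup>2)"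
  then show "summable (\<lambda>n. (cmod (a n - b n))\<^sup>2)"
    using square_summable_add[of a "\<lambda>n. - b n"] by simp
qed
lift_definition scaleR_ell2 :: "real \<Rightarrow> ell2 \<Rightarrow> ell2" is "\<lambda>r a n. complex_of_real r * a n"
  by (rule square_summable_mult)
instance
  by standard (transfer; simp add: fun_eq_iff algebra_simps)+

end

lemma cinner_cnj: "cinner a b = cnj (cinner b a)"
proof (rule sums_unique2[OF cinner_sums])
  show "(\<lambda>n. coef a n * cnj (coef b n)) sums cnj (cinner b a)"
    using iffD2[OF sums_cnj cinner_sums[of b a]] by (simp add: mult.commute)
qed

lemma cinner_add_left: "cinner (a + b) c = cinner a c + cinner b c"
  using sums_add[OF cinner_sums[of a c] cinner_sums[of b c]]
  by (intro sums_unique2[OF cinner_sums]) (simp add: plus_ell2.rep_eq algebra_simps)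

lemma cinner_cscale_left: "cinner (cscale k a) c = k * cinner a c"
  using sums_mult[OF cinner_sums[of a c], of k]
  by (intro sums_unique2[OF cinner_sums]) (simp add: cscale.rep_eq algebra_simps)

lemma scaleR_ell2_cscale: "r *\<^sub>R (a :: ell2) = cscale (complex_of_real r) a"
  by transfer simp

lemma cinner_self_sums: "(\<lambda>n. (cmod (coef a n))\<^sup>2) sums Re (cinner a a)"
  using sums_Re[OF cinner_sums[of a a]] by (simp add: complex_mult_cnj cmod_power2)

instantiation ell2 :: real_inner
begin

definition inner_ell2 :: "ell2 \<Rightarrow> ell2 \<Rightarrow> real" where
  "inner_ell2 a b = Re (cinner a b)"
definition norm_ell2 :: "ell2 \<Rightarrow> real" where
  "norm_ell2 a = sqrt (inner a a)"
definition dist_ell2 :: "ell2 \<Rightarrow> ell2 \<Rightarrow> real" where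
  "dist_ell2 a b = norm (a - b)"
definition sgn_ell2 :: "ell2 \<Rightarrow> ell2" where
  "sgn_ell2 a = a /\<^sub>R norm a"
definition uniformity_ell2 :: "(ell2 \<times> ell2) filter" where
  "uniformity_ell2 = (INF e\<in>{0 <..}. principal {(a, b). dist a b < e})"
definition open_ell2 :: "ell2 set \<Rightarrow> bool" where
  "open_ell2 U \<longleftrightarrow> (\<forall>x\<in>U. \<forall>\<^sub>F (x', y) in uniformity. x' = x \<longrightarrow> y \<in> U)"

instance
proof
  fix a b c :: ell2 and r :: real
  show "inner a b = inner b a"
    unfolding inner_ell2_def by (subst cinner_cnj) simp
  show "inner (a + b) c = inner a c + inner b c"
    by (simp add: inner_ell2_def cinner_add_left)
  show "inner (r *\<^sub>R a) b = r * inner a b"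
    by (simp add: inner_ell2_def scaleR_ell2_cscale cinner_cscale_left)
  show "0 \<le> inner a a"
    using sums_le[OF _ sums_zero cinner_self_sums[of a]] by (simp add: inner_ell2_def)
  show "inner a a = 0 \<longleftrightarrow> a = 0"
  proof
    assume "inner a a = 0"
    then have "(\<lambda>n. (cmod (coef a n))\<^sup>2) sums 0"
      using cinner_self_sums[of a] by (simp add: inner_ell2_def)
    then have "(\<Sum>n. (cmod (coef a n))\<^sup>2) = 0"
      by (simp add: sums_iff)
    then have "\<forall>n. (cmod (coef a n))\<^sup>2 = 0"
      using suminf_eq_zero_iff[OF coef_square_summable, of a] by simp
    then show "a = 0"
      by (intro ell2_eqI) (simp add: zero_ell2.rep_eq)
  next
    assume "a = 0"
    then show "inner a a = 0"
      by (simp add: inner_ell2_def cinner_def zero_ell2.rep_eq)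
  qed
qed (simp_all add: sgn_ell2_def norm_ell2_def dist_ell2_def uniformity_ell2_def open_ell2_def)

end

lemmas coef_simps [simp] = zero_ell2.rep_eq plus_ell2.rep_eq uminus_ell2.rep_eq
  minus_ell2.rep_eq cscale.rep_eq

lemma coef_scaleR [simp]: "coef (r *\<^sub>R a) n = complex_of_real r * coef a n"
  by (simp add: scaleR_ell2.rep_eq)

lemma coef_sum [simp]: "coef (sum f I) n = (\<Sum>i\<in>I. coef (f i) n)"
  by (induction I rule: infinite_finite_induct) auto

lemma norm_ell2_sums: "(\<lambda>n. (cmod (coef a n))\<^sup>2) sums (norm a)\<^sup>2"
  using cinner_self_sums[of a] by (simp add: power2_norm_eq_inner inner_ell2_def)

lemma cinner_self: "cinner a a = complex_of_real ((norm a)\<^sup>2)"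
proof -
  have "Im (cinner a a) = 0"
    using arg_cong[OF cinner_cnj[of a a], of Im] by simp
  then show ?thesis
    by (simp add: complex_eq_iff power2_norm_eq_inner inner_ell2_def)
qed

text \<open>
  The real inner product with \<open>b\<close> and with \<open>\<i> b\<close> recovers the complex one, so on a complex
  subspace real and complex orthogonality agree.
\<close>

lemma cinner_eq_inner: "cinner a b = Complex (inner a b) (inner a (cscale \<i> b))"
proof -
  have "cinner a (cscale \<i> b) = - \<i> * cinner a b"
    using cinner_cnj[of a "cscale \<i> b"] cinner_cnj[of a b] by (simp add: cinner_cscale_left)
  then show ?thesis
    by (simp add: complex_eq_iff inner_ell2_def)
qed

lemma cinner_cscale_right: "cinner a (cscale k b) = cnj k * cinner a b"
  using cinner_cnj[of a "cscale k b"] cinner_cnj[of a b] by (simp add: cinner_cscale_left)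

lemma cinner_add_right: "cinner a (b + c) = cinner a b + cinner a c"
  using cinner_cnj[of a "b + c"] cinner_cnj[of a b] cinner_cnj[of a c]
  by (simp add: cinner_add_left)

lemma cinner_zero [simp]: "cinner 0 a = 0" "cinner a 0 = 0"
  by (simp_all add: cinner_def)

lemma cinner_minus_left: "cinner (a - b) c = cinner a c - cinner b c"
  using cinner_add_left[of "a - b" b c] by simp

lemma cinner_minus_right: "cinner c (a - b) = cinner c a - cinner c b"
  using cinner_add_right[of c "a - b" b] by simp

lemma cinner_sum_left: "cinner (sum f I) c = (\<Sum>i\<in>I. cinner (f i) c)"
  by (induction I rule: infinite_finite_induct) (auto simp: cinner_add_left)

lemma cinner_sum_right: "cinner c (sum f I) = (\<Sum>i\<in>I. cinner c (f i))"
  by (induction I rule: infinite_finite_induct) (auto simp: cinner_add_right)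

lemma norm_cscale: "norm (cscale k a) = cmod k * norm a"
proof -
  have "(norm (cscale k a))\<^sup>2 = (cmod k * norm a)\<^sup>2"
    using sums_mult[OF norm_ell2_sums[of a], of "(cmod k)\<^sup>2"]
    by (intro sums_unique2[OF norm_ell2_sums]) (simp add: norm_mult power_mult_distrib)
  then show ?thesis by simp
qed

lemma norm_coef_le: "cmod (coef a n) \<le> norm a"
proof -
  have "(\<Sum>i\<in>{n}. (cmod (coef a i))\<^sup>2) \<le> (norm a)\<^sup>2"
    using sum_le_suminf[OF coef_square_summable[of a], of "{n}"] norm_ell2_sums[of a]
    by (simp add: sums_iff)
  then have "(cmod (coef a n))\<^sup>2 \<le> (norm a)\<^sup>2" by simp
  then show ?thesis by (rule power2_le_imp_le) simp
qed

text \<open>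
  The coordinates of a Cauchy sequence converge, and the Cauchy estimate, which holds for
  partial sums of the squared distance, survives the limit in one of the two indices.
\<close>

instance ell2 :: banach
proof
  fix X :: "nat \<Rightarrow> ell2"
  assume "Cauchy X"
  have "Cauchy (\<lambda>m. coef (X m) n)" for n
  proof (rule metric_CauchyI)
    fix e :: real assume "0 < e"
    then obtain M where M: "\<And>m k. M \<le> m \<Longrightarrow> M \<le> k \<Longrightarrow> dist (X m) (X k) < e"
      using metric_CauchyD[OF \<open>Cauchy X\<close>] by metis
    have "dist (coef (X m) n) (coef (X k) n) < e" if "M \<le> m" "M \<le> k" for m k
      using M[OF that] norm_coef_le[of "X m - X k" n] by (simp add: dist_norm)
    then show "\<exists>M. \<forall>m\<ge>M. \<forall>k\<ge>M. dist (coef (X m) n) (coef (X k) n) < e" by blast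
  qed
  then have "\<exists>x. \<forall>n. (\<lambda>m. coef (X m) n) \<longlonglongrightarrow> x n"
    by (intro choice) (simp add: Cauchy_convergent_iff convergent_def)
  then obtain x where x: "\<And>n. (\<lambda>m. coef (X m) n) \<longlonglongrightarrow> x n" by blast
  have close: "\<exists>M. \<forall>m\<ge>M. \<forall>J. (\<Sum>j<J. (cmod (coef (X m) j - x j))\<^sup>2) \<le> e\<^sup>2" if "0 < e" for e
  proof -
    obtain M where M: "\<And>m k. M \<le> m \<Longrightarrow> M \<le> k \<Longrightarrow> dist (X m) (X k) < e"
      using metric_CauchyD[OF \<open>Cauchy X\<close> \<open>0 < e\<close>] by metis
    have "(\<Sum>j<J. (cmod (coef (X m) j - x j))\<^sup>2) \<le> e\<^sup>2" if "M \<le> m" for m J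
    proof (rule LIMSEQ_le_const2)
      show "(\<lambda>k. \<Sum>j<J. (cmod (coef (X m) j - coef (X k) j))\<^sup>2)
              \<longlonglongrightarrow> (\<Sum>j<J. (cmod (coef (X m) j - x j))\<^sup>2)"
        by (intro tendsto_intros x)
      have "(\<Sum>j<J. (cmod (coef (X m) j - coef (X k) j))\<^sup>2) \<le> e\<^sup>2" if "M \<le> k" for k
      proof -
        have "(\<Sum>j<J. (cmod (coef (X m - X k) j))\<^sup>2) \<le> (norm (X m - X k))\<^sup>2"
          using sum_le_suminf[OF coef_square_summable[of "X m - X k"], of "{..<J}"]
            norm_ell2_sums[of "X m - X k"] by (simp add: sums_iff)
        also have "\<dots> \<le> e\<^sup>2"
          using M[OF \<open>M \<le> m\<close> \<open>M \<le> k\<close>] by (intro power_mono) (auto simp: dist_norm)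
        finally show ?thesis by simp
      qed
      then show "\<exists>N. \<forall>k\<ge>N. (\<Sum>j<J. (cmod (coef (X m) j - coef (X k) j))\<^sup>2) \<le> e\<^sup>2" by blast
    qed
    then show ?thesis by blast
  qed
  have tail: "summable (\<lambda>n. (cmod (coef (X m) n - x n))\<^sup>2)"
    if "\<forall>J. (\<Sum>j<J. (cmod (coef (X m) j - x j))\<^sup>2) \<le> r" for m r
    using that by (intro summableI_nonneg_bounded[where x = r]) auto
  obtain m0 where m0: "\<forall>J. (\<Sum>j<J. (cmod (coef (X m0) j - x j))\<^sup>2) \<le> 1\<^sup>2"
    using close[of 1] by auto
  have "summable (\<lambda>n. (cmod (x n))\<^sup>2)"
    using square_summable_add[OF coef_square_summable[of "X m0"]
        square_summable_mult[OF tail[OF m0], of "-1"]] by simp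
  then have coefx: "coef (Ell2 x) = x" by (rule coef_Ell2)
  have "X \<longlonglongrightarrow> Ell2 x"
  proof (rule LIMSEQ_I)
    fix r :: real assume "0 < r"
    then obtain M where M: "\<And>m. m \<ge> M \<Longrightarrow> \<forall>J. (\<Sum>j<J. (cmod (coef (X m) j - x j))\<^sup>2) \<le> (r / 2)\<^sup>2"
      using close[of "r / 2"] by auto
    have "norm (X m - Ell2 x) < r" if "M \<le> m" for m
    proof -
      have "(norm (X m - Ell2 x))\<^sup>2 \<le> (r / 2)\<^sup>2"
      proof (rule LIMSEQ_le_const2)
        show "(\<lambda>J. \<Sum>j<J. (cmod (coef (X m - Ell2 x) j))\<^sup>2) \<longlonglongrightarrow> (norm (X m - Ell2 x))\<^sup>2"
          using norm_ell2_sums[of "X m - Ell2 x"] unfolding sums_def .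
        show "\<exists>N. \<forall>J\<ge>N. (\<Sum>j<J. (cmod (coef (X m - Ell2 x) j))\<^sup>2) \<le> (r / 2)\<^sup>2"
          using M[OF that] unfolding minus_ell2.rep_eq coefx by blast
      qed
      then have "norm (X m - Ell2 x) \<le> r / 2"
        by (rule power2_le_imp_le) (use \<open>0 < r\<close> in simp)
      then show ?thesis
        using \<open>0 < r\<close> by linarith
    qed
    then show "\<exists>M. \<forall>m\<ge>M. norm (X m - Ell2 x) < r" by blast
  qed
  then show "convergent X" by (rule convergentI)
qed

section \<open>The shift and orthonormal systems\<close>

lemma bounded_linear_coef: "bounded_linear (\<lambda>a. coef a n)"
  by (rule bounded_linear_intro[where K = 1]) (auto simp: norm_coef_le scaleR_conv_of_real)

lemma tendsto_cinner_left:
  assumes "X \<longlonglongrightarrow> x"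
  shows "(\<lambda>n. cinner (X n) a) \<longlonglongrightarrow> cinner x a"
  unfolding cinner_eq_inner by (intro tendsto_Complex tendsto_inner assms tendsto_const)

lift_definition shift :: "ell2 \<Rightarrow> ell2" is "\<lambda>a n. case n of 0 \<Rightarrow> 0 | Suc m \<Rightarrow> a m"
  by (subst summable_Suc_iff[symmetric]) simp

lift_definition unit_vector :: "nat \<Rightarrow> ell2" is "\<lambda>j n. if n = j then 1 else 0"
  by (rule summable_finite[of "{j}" for j]) auto

lemma coef_shift_0 [simp]: "coef (shift a) 0 = 0"
  and coef_shift_Suc [simp]: "coef (shift a) (Suc n) = coef a n"
  by (simp_all add: shift.rep_eq)

lemma cscale_0_1 [simp]: "cscale 0 a = 0" "cscale 1 a = a"
  by (rule ell2_eqI; simp)+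

lemma coef_shift_power: "coef ((shift ^^ n) a) m = (if m < n then 0 else coef a (m - n))"
proof (induction n arbitrary: m)
  case (Suc n)
  then show ?case by (cases m) auto
qed simp

lemma cinner_shift: "cinner (shift a) (shift b) = cinner a b"
proof (rule sums_unique2[OF cinner_sums])
  show "(\<lambda>n. coef (shift a) n * cnj (coef (shift b) n)) sums cinner a b"
    using sums_Suc_iff[of "\<lambda>n. coef (shift a) n * cnj (coef (shift b) n)" "cinner a b"] cinner_sums[of a b]
    by simp
qed

lemma cinner_shift_power: "cinner ((shift ^^ n) a) ((shift ^^ n) b) = cinner a b"
  by (induction n) (auto simp: cinner_shift)

lemma cinner_unit_vector: "cinner (unit_vector j) a = cnj (coef a j)"
proof (rule sums_unique2[OF cinner_sums])
  show "(\<lambda>n. coef (unit_vector j) n * cnj (coef a n)) sums cnj (coef a j)"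
    using sums_If_finite_set[of "{j}" "\<lambda>n. cnj (coef a n)"]
    by (simp add: unit_vector.rep_eq if_distrib[of "\<lambda>x. x * _"] cong: if_cong)
qed

lemma norm_unit_vector: "norm (unit_vector j) = 1"
proof -
  have "cinner (unit_vector j) (unit_vector j) = 1"
    by (simp add: cinner_unit_vector unit_vector.rep_eq)
  then have "(norm (unit_vector j))\<^sup>2 = 1\<^sup>2"
    by (simp add: cinner_self flip: of_real_power)
  then show ?thesis by (rule power2_eq_imp_eq) auto
qed

text \<open>
  The sum \<open>p\<close> of the components of \<open>x\<close> along the \<open>u i\<close> satisfies
  \<open>x - p \<bottom> p\<close>, so the defect in the inequality is \<open>\<parallel>x - p\<parallel>\<^sup>2\<close>.
\<close>

lemma bessel:
  assumes "finite I"
    and on: "\<And>i j. i \<in> I \<Longrightarrow> j \<in> I \<Longrightarrow> cinner (u i) (u j) = of_bool (i = j)"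
  shows "(\<Sum>i\<in>I. (cmod (cinner x (u i)))\<^sup>2) \<le> (norm x)\<^sup>2"
proof -
  define p where "p = (\<Sum>i\<in>I. cscale (cinner x (u i)) (u i))"
  have up: "cinner p (u j) = cinner x (u j)" if "j \<in> I" for j
  proof -
    have "cinner p (u j) = (\<Sum>i\<in>I. if i = j then cinner x (u i) else 0)"
      unfolding p_def cinner_sum_left
      by (rule sum.cong) (auto simp: cinner_cscale_left on that)
    then show ?thesis using that \<open>finite I\<close> by simp
  qed
  have "cinner (x - p) (\<Sum>i\<in>I. cscale (cinner x (u i)) (u i)) = 0"
    unfolding cinner_sum_right by (simp add: cinner_cscale_right cinner_minus_left up)
  then have orth: "cinner (x - p) p = 0" by (simp only: p_def)
  have px: "cinner p x = complex_of_real (\<Sum>i\<in>I. (cmod (cinner x (u i)))\<^sup>2)"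
    unfolding p_def cinner_sum_left of_real_sum
  proof (rule sum.cong)
    fix i
    show "cinner (cscale (cinner x (u i)) (u i)) x = complex_of_real ((cmod (cinner x (u i)))\<^sup>2)"
      by (simp add: cinner_cscale_left cinner_cnj[of "u i" x] complex_norm_square del: of_real_power)
  qed simp
  have "complex_of_real ((norm (x - p))\<^sup>2) = cinner (x - p) x - cinner (x - p) p"
    unfolding cinner_self[symmetric] by (rule cinner_minus_right)
  also have "\<dots> = complex_of_real ((norm x)\<^sup>2 - (\<Sum>i\<in>I. (cmod (cinner x (u i)))\<^sup>2))"
    by (simp add: orth cinner_minus_left[of x p x] px cinner_self)
  finally have "(norm (x - p))\<^sup>2 = (norm x)\<^sup>2 - (\<Sum>i\<in>I. (cmod (cinner x (u i)))\<^sup>2)"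
    using of_real_eq_iff by blast
  then show ?thesis
    by (metis diff_ge_0_iff_ge zero_le_power2)
qed

section \<open>Orthogonal projection onto closed subspaces\<close>

text \<open>
  A sequence in \<open>S\<close> whose distances from \<open>x\<close> tend to the infimum is Cauchy by the
  parallelogram law. Its limit \<open>p\<close> is a nearest point, and moving from \<open>p\<close> along \<open>y\<close> cannot
  decrease the distance, which forces \<open>x - p \<bottom> y\<close>.
\<close>

lemma closed_subspace_orthogonal_decomposition:
  fixes S :: "'a :: {real_inner, complete_space} set"
  assumes "subspace S" "closed S"
  obtains p where "p \<in> S" "\<And>y. y \<in> S \<Longrightarrow> inner (x - p) y = 0"
proof -
  define D where "D = Inf ((\<lambda>y. (norm (x - y))\<^sup>2) ` S)"
  have "S \<noteq> {}" using subspace_0[OF assms(1)] by blast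
  have bdd: "bdd_below ((\<lambda>y. (norm (x - y))\<^sup>2) ` S)"
    by (rule bdd_belowI[of _ 0]) auto
  have D: "D \<le> (norm (x - y))\<^sup>2" if "y \<in> S" for y
    unfolding D_def using that bdd by (intro cInf_lower) auto
  have "\<exists>y\<in>S. (norm (x - y))\<^sup>2 < D + inverse (real (Suc n))" for n
    using cInf_lessD[of "(\<lambda>y. (norm (x - y))\<^sup>2) ` S" "D + inverse (real (Suc n))"] \<open>S \<noteq> {}\<close>
    by (auto simp: D_def)
  then obtain y where y: "\<And>n. y n \<in> S" "\<And>n. (norm (x - y n))\<^sup>2 < D + inverse (real (Suc n))"
    by metis
  \<comment> \<open>the parallelogram law with vertices \<open>x\<close>, \<open>y m\<close>, \<open>y n\<close>; the midpoint lies in \<open>S\<close>\<close>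
  have near: "(norm (y m - y n))\<^sup>2 < 2 * inverse (real (Suc m)) + 2 * inverse (real (Suc n))" for m n
  proof -
    have "(1/2) *\<^sub>R (y m + y n) \<in> S"
      using assms(1) y by (intro subspace_scale subspace_add)
    from D[OF this] have "4 * D \<le> 4 * (norm (x - (1/2) *\<^sub>R (y m + y n)))\<^sup>2" by simp
    also have "\<dots> = 2 * (norm (x - y m))\<^sup>2 + 2 * (norm (x - y n))\<^sup>2 - (norm (y m - y n))\<^sup>2"
      by (simp add: power2_norm_eq_inner inner_simps inner_commute algebra_simps)
    finally show ?thesis using y(2)[of m] y(2)[of n] by linarith
  qed
  have "Cauchy y"
  proof (rule metric_CauchyI)
    fix e :: real assume "0 < e"
    then obtain N where N: "inverse (real (Suc N)) < e\<^sup>2 / 4"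
      using reals_Archimedean[of "e\<^sup>2 / 4"] by auto
    have "dist (y m) (y n) < e" if "N \<le> m" "N \<le> n" for m n
    proof -
      have "inverse (real (Suc m)) \<le> inverse (real (Suc N))"
        "inverse (real (Suc n)) \<le> inverse (real (Suc N))"
        using that by (auto intro!: le_imp_inverse_le)
      then have "(norm (y m - y n))\<^sup>2 < e\<^sup>2"
        using near[of m n] N by linarith
      then show ?thesis
        using \<open>0 < e\<close> by (simp add: dist_norm power2_less_imp_less)
    qed
    then show "\<exists>N. \<forall>m\<ge>N. \<forall>n\<ge>N. dist (y m) (y n) < e" by blast
  qed
  then obtain p where p: "y \<longlonglongrightarrow> p"
    using Cauchy_convergent convergentD by blast
  have "p \<in> S"
    using closed_sequentially[OF assms(2) _ p] y(1) by blast
  have "(norm (x - p))\<^sup>2 \<le> D"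
  proof (rule LIMSEQ_le)
    show "(\<lambda>n. (norm (x - y n))\<^sup>2) \<longlonglongrightarrow> (norm (x - p))\<^sup>2"
      by (intro tendsto_intros p)
    show "(\<lambda>n. D + inverse (real (Suc n))) \<longlonglongrightarrow> D"
      using tendsto_add[OF tendsto_const[of D] LIMSEQ_inverse_real_of_nat] by simp
    show "\<exists>N. \<forall>n\<ge>N. (norm (x - y n))\<^sup>2 \<le> D + inverse (real (Suc n))"
      using y(2) less_imp_le by blast
  qed
  have "inner (x - p) z = 0" if "z \<in> S" for z
  proof (rule ccontr)
    assume nz: "inner (x - p) z \<noteq> 0"
    then have "z \<noteq> 0" by auto
    \<comment> \<open>the minimiser of \<open>\<parallel>(x - p) - t z\<parallel>\<close> over real \<open>t\<close>\<close>
    define t where "t = inner (x - p) z / inner z z"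
    have S: "p + t *\<^sub>R z \<in> S"
      using assms(1) \<open>p \<in> S\<close> that by (intro subspace_add subspace_scale)
    have "x - (p + t *\<^sub>R z) = (x - p) - t *\<^sub>R z" by simp
    then have "(norm (x - p))\<^sup>2 \<le> (norm ((x - p) - t *\<^sub>R z))\<^sup>2"
      using \<open>(norm (x - p))\<^sup>2 \<le> D\<close> D[OF S] by (simp only:)
    also have "\<dots> = (norm (x - p))\<^sup>2 - 2 * (t * inner (x - p) z) + t * (t * inner z z)"
      unfolding power2_norm_eq_inner inner_diff_left inner_diff_right
      by (simp add: inner_simps inner_commute algebra_simps)
    also have "t * inner z z = inner (x - p) z"
      using \<open>z \<noteq> 0\<close> by (simp add: t_def)
    finally have "t * inner (x - p) z \<le> 0" by simp
    moreover have "0 < t * inner (x - p) z"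
      using nz \<open>z \<noteq> 0\<close> by (simp add: t_def power2_eq_square[symmetric])
    ultimately show False by simp
  qed
  then show ?thesis using that \<open>p \<in> S\<close> by blast
qed

section \<open>Beurling's theorem for the shift\<close>

definition csubspace :: "ell2 set \<Rightarrow> bool" where
  "csubspace L \<longleftrightarrow> 0 \<in> L \<and> (\<forall>a\<in>L. \<forall>b\<in>L. a + b \<in> L) \<and> (\<forall>k. \<forall>a\<in>L. cscale k a \<in> L)"

lemma csubspace_subspace: "csubspace L \<Longrightarrow> subspace L"
  by (simp add: csubspace_def subspace_def scaleR_ell2_cscale)

lemma csubspace_sum: "csubspace L \<Longrightarrow> (\<And>i. i \<in> I \<Longrightarrow> f i \<in> L) \<Longrightarrow> sum f I \<in> L"
  by (rule subspace_sum[OF csubspace_subspace])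

lemma csubspace_orthogonal:
  assumes "csubspace L" "\<And>y. y \<in> L \<Longrightarrow> inner x y = 0" "y \<in> L"
  shows "cinner x y = 0"
  using assms by (auto simp: cinner_eq_inner csubspace_def complex_eq_iff)

definition shift_orthonormal :: "ell2 \<Rightarrow> bool" where
  "shift_orthonormal b \<longleftrightarrow> (\<forall>m n. cinner ((shift ^^ m) b) ((shift ^^ n) b) = of_bool (m = n))"

lemma shift_orthonormalI:
  assumes "norm b = 1" "\<And>n. cinner ((shift ^^ Suc n) b) b = 0"
  shows "shift_orthonormal b"
proof -
  have gt: "cinner ((shift ^^ m) b) ((shift ^^ n) b) = 0" if "n < m" for m n
  proof -
    have "\<exists>k. m = n + Suc k" using that by presburger
    then obtain k where "m = n + Suc k" by blast
    then have "(shift ^^ m) b = (shift ^^ n) ((shift ^^ Suc k) b)"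
      by (simp only: funpow_add o_apply)
    then show ?thesis by (simp only: cinner_shift_power assms)
  qed
  have "cinner ((shift ^^ m) b) ((shift ^^ n) b) = of_bool (m = n)" for m n
  proof (cases m n rule: linorder_cases)
    case less
    then show ?thesis
      using gt[of m n] cinner_cnj[of "(shift ^^ m) b" "(shift ^^ n) b"] by simp
  next
    case equal
    then show ?thesis using cinner_shift_power[of n b b] by (simp add: cinner_self assms(1))
  next
    case greater
    then show ?thesis using gt by simp
  qed
  then show ?thesis unfolding shift_orthonormal_def by blast
qed

text \<open>
  Asking only for orthogonality to \<open>S L\<close> would leave open whether \<open>S L\<close> is a proper subspace.
  The larger subspace \<open>{a \<in> L. a\<^sub>k = 0}\<close>, for the least \<open>k\<close> at which \<open>L\<close> does not vanish,
  is visibly closed and proper, and it contains \<open>S L\<close> since the elements of \<open>L\<close> vanish below \<open>k\<close>.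
\<close>

lemma wandering_vector_exists:
  assumes "csubspace L" "closed L" "shift ` L \<subseteq> L" "L \<noteq> {0}"
  obtains b where "b \<in> L" "norm b = 1" "\<And>a. a \<in> L \<Longrightarrow> cinner (shift a) b = 0"
proof -
  have "\<exists>k. \<exists>a\<in>L. coef a k \<noteq> 0"
  proof (rule ccontr)
    assume "\<not> ?thesis"
    then have "a = 0" if "a \<in> L" for a
      using that by (intro ell2_eqI) simp
    moreover have "0 \<in> L" using assms(1) by (simp add: csubspace_def)
    ultimately show False using assms(4) by blast
  qed
  then obtain k where k: "\<exists>a\<in>L. coef a k \<noteq> 0" "\<And>i a. i < k \<Longrightarrow> a \<in> L \<Longrightarrow> coef a i = 0"
    using exists_least_iff[of "\<lambda>k. \<exists>a\<in>L. coef a k \<noteq> 0"] by blast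
  then obtain x where x: "x \<in> L" "coef x k \<noteq> 0" by blast
  define L' where "L' = {a \<in> L. coef a k = 0}"
  have sub': "csubspace L'"
    using assms(1) by (auto simp: csubspace_def L'_def)
  have "closed L'"
    unfolding closed_sequential_limits
  proof safe
    fix X l assume X: "\<forall>n. X n \<in> L'" "X \<longlonglongrightarrow> l"
    have "(\<lambda>n. coef (X n) k) \<longlonglongrightarrow> coef l k"
      by (rule bounded_linear.tendsto[OF bounded_linear_coef X(2)])
    then have "coef l k = 0"
      using X(1) by (simp add: L'_def LIMSEQ_const_iff)
    moreover have "l \<in> L"
      using closed_sequentially[OF assms(2) _ X(2)] X(1) by (auto simp: L'_def)
    ultimately show "l \<in> L'" by (simp add: L'_def)
  qed
  then obtain p where p: "p \<in> L'" "\<And>y. y \<in> L' \<Longrightarrow> inner (x - p) y = 0"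
    using closed_subspace_orthogonal_decomposition[OF csubspace_subspace[OF sub'], of x] by blast
  have orth: "cinner y (x - p) = 0" if "y \<in> L'" for y
    using csubspace_orthogonal[OF sub' p(2) that] cinner_cnj[of y "x - p"] by simp
  have "coef (x - p) k \<noteq> 0" using x p(1) by (simp add: L'_def)
  then have nz: "norm (x - p) \<noteq> 0" by auto
  have sh: "shift a \<in> L'" if "a \<in> L" for a
    using that assms(3) k(2)[of "k - 1" a] by (cases k) (auto simp: L'_def)
  show ?thesis
  proof (rule that)
    show "cscale (complex_of_real (1 / norm (x - p))) (x - p) \<in> L"
      using subspace_diff[OF csubspace_subspace[OF assms(1)] x(1), of p] p(1) assms(1)
      by (auto simp: csubspace_def L'_def)
    show "norm (cscale (complex_of_real (1 / norm (x - p))) (x - p)) = 1"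
      using nz by (simp add: norm_cscale norm_divide)
    show "cinner (shift a) (cscale (complex_of_real (1 / norm (x - p))) (x - p)) = 0"
      if "a \<in> L" for a
      using orth[OF sh[OF that]] by (simp add: cinner_cscale_right)
  qed
qed

lemma shift_power_mem: "shift ` L \<subseteq> L \<Longrightarrow> a \<in> L \<Longrightarrow> (shift ^^ n) a \<in> L"
  by (induction n) auto

lemma wandering_shift_orthonormal:
  assumes "shift ` L \<subseteq> L" "b \<in> L" "norm b = 1" "\<And>a. a \<in> L \<Longrightarrow> cinner (shift a) b = 0"
  shows "shift_orthonormal b"
  using assms shift_power_mem[OF assms(1,2)] by (intro shift_orthonormalI) auto

text \<open>
  When the orbit of \<open>b\<close> under the shift is orthonormal, this is the Cauchy product of \<open>b\<close> and \<open>c\<close>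
  (\<open>coef_shift_series\<close>), written as an orthogonal series so that isometry and membership in a
  closed invariant subspace can be read off its partial sums.
\<close>

definition shift_series :: "ell2 \<Rightarrow> ell2 \<Rightarrow> ell2" where
  "shift_series b c = (\<Sum>n. cscale (coef c n) ((shift ^^ n) b))"

lemma norm_orthonormal_sum:
  assumes "shift_orthonormal b" "finite I"
  shows "(norm (\<Sum>n\<in>I. cscale (c n) ((shift ^^ n) b)))\<^sup>2 = (\<Sum>n\<in>I. (cmod (c n))\<^sup>2)"
proof -
  have "cinner (\<Sum>n\<in>I. cscale (c n) ((shift ^^ n) b)) (\<Sum>n\<in>I. cscale (c n) ((shift ^^ n) b))
      = (\<Sum>m\<in>I. \<Sum>n\<in>I. if m = n then c m * cnj (c m) else 0)"
    unfolding cinner_sum_left cinner_sum_right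
    using assms(1)
    by (intro sum.cong refl) (auto simp: cinner_cscale_left cinner_cscale_right shift_orthonormal_def)
  also have "\<dots> = complex_of_real (\<Sum>n\<in>I. (cmod (c n))\<^sup>2)"
    using assms(2) by (simp add: complex_norm_square del: of_real_power)
  finally show ?thesis
    unfolding cinner_self using of_real_eq_iff by blast
qed

lemma sum_atMost_flip: "(\<Sum>i\<le>n. f (n - i)) = (\<Sum>i\<le>(n :: nat). f i)"
  by (rule sum.reindex_bij_witness[of _ "\<lambda>i. n - i" "\<lambda>i. n - i"]) auto

lemma shift_series_sums:
  assumes "shift_orthonormal b"
  shows "(\<lambda>n. cscale (coef c n) ((shift ^^ n) b)) sums shift_series b c"
  unfolding shift_series_def
proof (rule summable_sums, unfold summable_Cauchy, intro allI impI)
  fix e :: real assume "0 < e"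
  then obtain N where N: "\<And>m n. m \<ge> N \<Longrightarrow> norm (\<Sum>i\<in>{m..<n}. (cmod (coef c i))\<^sup>2) < e\<^sup>2"
    using coef_square_summable[of c, unfolded summable_Cauchy] by (meson zero_less_power)
  have "norm (\<Sum>i\<in>{m..<n}. cscale (coef c i) ((shift ^^ i) b)) < e" if "m \<ge> N" for m n
  proof (rule power2_less_imp_less)
    show "(norm (\<Sum>i\<in>{m..<n}. cscale (coef c i) ((shift ^^ i) b)))\<^sup>2 < e\<^sup>2"
      using N[OF that, of n] by (simp add: norm_orthonormal_sum[OF assms])
  qed (use \<open>0 < e\<close> in simp)
  then show "\<exists>N. \<forall>m\<ge>N. \<forall>n. norm (\<Sum>i\<in>{m..<n}. cscale (coef c i) ((shift ^^ i) b)) < e"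
    by blast
qed

lemma coef_shift_series:
  assumes "shift_orthonormal b"
  shows "coef (shift_series b c) n = (\<Sum>m\<le>n. coef b m * coef c (n - m))"
proof -
  have "(\<lambda>m. coef (cscale (coef c m) ((shift ^^ m) b)) n) sums coef (shift_series b c) n"
    by (rule bounded_linear.sums[OF bounded_linear_coef shift_series_sums[OF assms]])
  moreover have "(\<lambda>m. coef (cscale (coef c m) ((shift ^^ m) b)) n)
      sums (\<Sum>m\<le>n. coef (cscale (coef c m) ((shift ^^ m) b)) n)"
    by (rule sums_finite) (auto simp: coef_shift_power)
  ultimately have "coef (shift_series b c) n = (\<Sum>m\<le>n. coef c m * coef b (n - m))"
    using sums_unique2 by (fastforce simp: coef_shift_power intro: sum.cong)
  also have "\<dots> = (\<Sum>m\<le>n. coef c (n - m) * coef b m)"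
    using sum_atMost_flip[of "\<lambda>m. coef c m * coef b (n - m)" n] by simp
  finally show ?thesis by (simp add: mult.commute)
qed

lemma norm_shift_series:
  assumes "shift_orthonormal b"
  shows "norm (shift_series b c) = norm c"
proof -
  have "(\<lambda>J. (norm (\<Sum>n<J. cscale (coef c n) ((shift ^^ n) b)))\<^sup>2) \<longlonglongrightarrow> (norm (shift_series b c))\<^sup>2"
    using shift_series_sums[OF assms, of c] unfolding sums_def by (intro tendsto_intros)
  then have "(\<lambda>n. (cmod (coef c n))\<^sup>2) sums (norm (shift_series b c))\<^sup>2"
    by (simp add: norm_orthonormal_sum[OF assms] sums_def)
  from sums_unique2[OF this norm_ell2_sums] show ?thesis by simp
qed

lemma shift_series_mem:
  assumes "shift_orthonormal b" "csubspace L" "closed L" "shift ` L \<subseteq> L" "b \<in> L"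
  shows "shift_series b c \<in> L"
proof (rule closed_sequentially[OF assms(3)])
  show "(\<lambda>J. \<Sum>n<J. cscale (coef c n) ((shift ^^ n) b)) \<longlonglongrightarrow> shift_series b c"
    using shift_series_sums[OF assms(1), of c] unfolding sums_def .
  show "(\<Sum>n<J. cscale (coef c n) ((shift ^^ n) b)) \<in> L" for J
    using assms(2) shift_power_mem[OF assms(4,5)]
    by (intro csubspace_sum) (auto simp: csubspace_def)
qed

lemma closed_range_shift_series:
  assumes "shift_orthonormal b"
  shows "closed (range (shift_series b))" "csubspace (range (shift_series b))"
proof -
  have add: "shift_series b (c + d) = shift_series b c + shift_series b d" for c d
    by (rule ell2_eqI) (simp add: coef_shift_series[OF assms] algebra_simps sum.distrib)
  have scale: "shift_series b (cscale k c) = cscale k (shift_series b c)" for c k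
    by (rule ell2_eqI) (simp add: coef_shift_series[OF assms] algebra_simps sum_distrib_left)
  have "bounded_linear (shift_series b)"
    by (rule bounded_linear_intro[where K = 1])
       (auto simp: add scale scaleR_ell2_cscale norm_shift_series[OF assms])
  then have "complete (range (shift_series b))"
    by (intro complete_isometric_image[where e = 1])
       (auto simp: norm_shift_series[OF assms] complete_UNIV)
  then show "closed (range (shift_series b))" by (rule complete_imp_closed)
  have "shift_series b 0 = 0"
    using norm_shift_series[OF assms, of 0] by simp
  then show "csubspace (range (shift_series b))"
    unfolding csubspace_def by (auto simp flip: add scale intro: range_eqI[of _ _ 0])
qed

text \<open>
  Two orthonormal shift orbits are too large to be orthogonal to each other. The inner product
  of the \<open>j\<close>-th unit vector and \<open>S\<^sup>n b\<close> is the conjugate of \<open>b\<^sub>j\<^sub>-\<^sub>n\<close>, so Bessel's inequality bounds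
  the first \<open>j + 1\<close> terms of \<open>\<parallel>b\<parallel>\<^sup>2 + \<parallel>r\<parallel>\<^sup>2 = 2\<close> by \<open>1\<close>.
\<close>

lemma no_orthogonal_shift_orthonormal:
  assumes b: "shift_orthonormal b" and r: "shift_orthonormal r"
  shows "\<exists>m n. cinner ((shift ^^ m) r) ((shift ^^ n) b) \<noteq> 0"
proof (rule ccontr)
  assume "\<not> ?thesis"
  then have rb: "cinner ((shift ^^ m) r) ((shift ^^ n) b) = 0" for m n by blast
  then have br: "cinner ((shift ^^ n) b) ((shift ^^ m) r) = 0" for m n
    by (subst cinner_cnj) simp
  have le: "(\<Sum>i\<le>j. (cmod (coef b i))\<^sup>2) + (\<Sum>i\<le>j. (cmod (coef r i))\<^sup>2) \<le> 1" for j
  proof -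
    define u where "u = case_sum (\<lambda>n. (shift ^^ n) b) (\<lambda>n. (shift ^^ n) r)"
    have "(\<Sum>i\<in>{..j} <+> {..j}. (cmod (cinner (unit_vector j) (u i)))\<^sup>2) \<le> (norm (unit_vector j))\<^sup>2"
      using b r by (intro bessel) (auto simp: u_def shift_orthonormal_def rb br)
    then have "(\<Sum>i\<le>j. (cmod (coef b (j - i)))\<^sup>2) + (\<Sum>i\<le>j. (cmod (coef r (j - i)))\<^sup>2) \<le> 1"
      by (simp add: sum.Plus u_def cinner_unit_vector norm_unit_vector coef_shift_power)
    then show ?thesis
      using sum_atMost_flip[of "\<lambda>i. (cmod (coef b i))\<^sup>2" j]
        sum_atMost_flip[of "\<lambda>i. (cmod (coef r i))\<^sup>2" j] by simp
  qed
  have "(\<lambda>j. (\<Sum>i\<le>j. (cmod (coef b i))\<^sup>2) + (\<Sum>i\<le>j. (cmod (coef r i))\<^sup>2))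
      \<longlonglongrightarrow> (norm b)\<^sup>2 + (norm r)\<^sup>2"
    using norm_ell2_sums by (intro tendsto_add) (simp_all add: sums_def_le)
  then have "(norm b)\<^sup>2 + (norm r)\<^sup>2 \<le> 1"
    using le by (intro LIMSEQ_le_const2) auto
  moreover have "(norm a)\<^sup>2 = 1" if "shift_orthonormal a" for a
  proof -
    have "complex_of_real ((norm a)\<^sup>2) = 1"
      using that[unfolded shift_orthonormal_def, rule_format, of 0 0] by (simp add: cinner_self)
    then show ?thesis using of_real_eq_1_iff by blast
  qed
  ultimately show False using b r by fastforce
qed

theorem beurling:
  assumes "csubspace L" "closed L" "shift ` L \<subseteq> L" "L \<noteq> {0}"
  obtains b where "shift_orthonormal b" "L = range (shift_series b)"
proof -
  obtain b where b: "b \<in> L" "norm b = 1" "\<And>a. a \<in> L \<Longrightarrow> cinner (shift a) b = 0"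
    using wandering_vector_exists[OF assms] by blast
  have on: "shift_orthonormal b"
    using wandering_shift_orthonormal[OF assms(3) b] .
  note K = closed_range_shift_series[OF on]
  have "range (shift_series b) \<subseteq> L"
    using shift_series_mem[OF on assms(1-3) b(1)] by blast
  moreover have "L \<subseteq> range (shift_series b)"
  proof
    fix x assume "x \<in> L"
    obtain p where p: "p \<in> range (shift_series b)"
      "\<And>y. y \<in> range (shift_series b) \<Longrightarrow> inner (x - p) y = 0"
      using closed_subspace_orthogonal_decomposition[OF csubspace_subspace[OF K(2)] K(1), of x] by blast
    define N where "N = {a \<in> L. \<forall>n. cinner a ((shift ^^ n) b) = 0}"
    have subN: "csubspace N"
      using assms(1) by (auto simp: csubspace_def N_def cinner_add_left cinner_cscale_left)
    have closedN: "closed N"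
      unfolding closed_sequential_limits
    proof safe
      fix X l assume X: "\<forall>n. X n \<in> N" "X \<longlonglongrightarrow> l"
      have "cinner l ((shift ^^ n) b) = 0" for n
        using tendsto_cinner_left[OF X(2), of "(shift ^^ n) b"] X(1)
        by (simp add: N_def LIMSEQ_const_iff)
      moreover have "l \<in> L"
        using closed_sequentially[OF assms(2) _ X(2)] X(1) by (auto simp: N_def)
      ultimately show "l \<in> N" by (simp add: N_def)
    qed
    \<comment> \<open>\<open>shift a\<close> is orthogonal to \<open>b\<close> by the choice of \<open>b\<close>, and to the other \<open>S\<^sup>n b\<close> because the shift is isometric\<close>
    have invN: "shift ` N \<subseteq> N"
    proof safe
      fix a assume a: "a \<in> N"
      then have "cinner (shift a) ((shift ^^ n) b) = 0" for n
        using b(3) by (cases n) (auto simp: N_def cinner_shift)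
      then show "shift a \<in> N" using a assms(3) by (auto simp: N_def)
    qed
    have "(shift ^^ n) b \<in> range (shift_series b)" for n
    proof
      show "(shift ^^ n) b = shift_series b (unit_vector n)"
        using sums_single[of n "\<lambda>m. (shift ^^ m) b"]
        by (simp add: shift_series_def unit_vector.rep_eq sums_iff if_distrib[of "\<lambda>k. cscale k _"] cong: if_cong)
    qed simp
    then have "x - p \<in> N"
      using csubspace_orthogonal[OF K(2) p(2)] \<open>x \<in> L\<close> p(1) \<open>range (shift_series b) \<subseteq> L\<close>
        subspace_diff[OF csubspace_subspace[OF assms(1)]]
      by (auto simp: N_def)
    have "N = {0}"
    proof (rule ccontr)
      assume "N \<noteq> {0}"
      then obtain r where r: "r \<in> N" "norm r = 1" "\<And>a. a \<in> N \<Longrightarrow> cinner (shift a) r = 0"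
        using wandering_vector_exists[OF subN closedN invN] by blast
      have "(shift ^^ m) r \<in> N" for m
        using shift_power_mem[OF invN r(1)] .
      then show False
        using no_orthogonal_shift_orthonormal[OF on wandering_shift_orthonormal[OF invN r]]
        by (auto simp: N_def)
    qed
    with \<open>x - p \<in> N\<close> p(1) show "x \<in> range (shift_series b)" by simp
  qed
  ultimately show ?thesis using that on by blast
qed

section \<open>The half lattice\<close>

lemma zero_half_lattice [simp]: "0 \<in> half_lattice"
  by (simp add: half_lattice_def)

lemma half_lattice_right [simp]: "z \<in> half_lattice \<Longrightarrow> z + 1 \<in> half_lattice"
  by (simp add: half_lattice_def)

lemma half_lattice_up_iff [simp]: "z + \<i> \<in> half_lattice \<longleftrightarrow> z \<in> half_lattice"
  using Ints_diff[of "Im z + 1" 1] by (auto simp: half_lattice_def)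

lemma half_lattice_induct [consumes 1, case_names zero right up down]:
  assumes "z \<in> half_lattice"
    and zero: "P 0"
    and right: "\<And>z. z \<in> half_lattice \<Longrightarrow> P z \<Longrightarrow> P (z + 1)"
    and up: "\<And>z. z \<in> half_lattice \<Longrightarrow> P z \<Longrightarrow> P (z + \<i>)"
    and down: "\<And>z. z \<in> half_lattice \<Longrightarrow> P (z + \<i>) \<Longrightarrow> P z"
  shows "P z"
proof -
  obtain m n where m: "Re z = of_int m" and n: "Im z = of_int n"
    using assms(1) by (auto simp: half_lattice_def Ints_def)
  have mem: "Complex 0 (of_int k) \<in> half_lattice" for k :: int
    by (simp add: half_lattice_def)
  have step: "Complex 0 (of_int (k + 1)) = Complex 0 (of_int k) + \<i>" for k :: int
    by (simp add: complex_eq_iff)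
  have vert: "P (Complex 0 (of_int k))" for k :: int
  proof (induction k rule: int_induct[where k = 0])
    case base
    then show ?case using zero by (simp add: zero_complex.code)
  next
    case (step1 i)
    then show ?case unfolding step by (intro up mem)
  next
    case (step2 i)
    then show ?case
      using down[OF mem[of "i - 1"]] step[of "i - 1"] by simp
  qed
  have "0 \<le> m" using m assms(1) by (simp add: half_lattice_def)
  then have "P (Complex (of_int m) (of_int n))"
  proof (induction m rule: int_ge_induct)
    case base
    then show ?case using vert by simp
  next
    case (step i)
    have "Complex (of_int (i + 1)) (of_int n) = Complex (of_int i) (of_int n) + 1"
      by (simp add: complex_eq_iff)
    moreover have "Complex (of_int i) (of_int n) \<in> half_lattice"
      using step by (simp add: half_lattice_def)
    ultimately show ?case using right step.IH by simp
  qed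
  then show ?thesis using m n by (cases z) simp
qed

section \<open>Primitives of discrete analytic functions\<close>

text \<open>
  The contribution of the edge from \<open>z\<close> to \<open>w\<close> to \<open>path_sum\<close>.
\<close>

definition edge_sum :: "(complex \<Rightarrow> complex) \<Rightarrow> complex \<Rightarrow> complex \<Rightarrow> complex" where
  "edge_sum f z w = (f z + f w) / 2 * (w - z)"

lemma edge_sum_swap: "edge_sum f w z = - edge_sum f z w"
  by (simp add: edge_sum_def field_simps)

definition primitive :: "(complex \<Rightarrow> complex) \<Rightarrow> (complex \<Rightarrow> complex) \<Rightarrow> bool" where
  "primitive F f \<longleftrightarrow> F 0 = 0 \<and>
     (\<forall>z\<in>half_lattice. F (z + 1) - F z = edge_sum f z (z + 1)
                      \<and> F (z + \<i>) - F z = edge_sum f z (z + \<i>))"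

text \<open>
  Discrete analyticity is the vanishing of the integral around each unit cell.
\<close>

lemma discrete_analytic_cell:
  assumes "discrete_analytic f" "z \<in> half_lattice"
  shows "edge_sum f z (z + 1) + edge_sum f (z + 1) (z + 1 + \<i>)
       = edge_sum f z (z + \<i>) + edge_sum f (z + \<i>) (z + 1 + \<i>)"
proof -
  have "(f (z + 1 + \<i>) - f z) / (1 + \<i>) = (f (z + 1) - f (z + \<i>)) / (1 - \<i>)"
    using assms by (simp add: discrete_analytic_def)
  moreover have "1 + \<i> \<noteq> 0" "1 - \<i> \<noteq> 0"
    by (simp_all add: complex_eq_iff)
  ultimately have "(f (z + 1 + \<i>) - f z) * (1 - \<i>) = (f (z + 1) - f (z + \<i>)) * (1 + \<i>)"
    by (simp add: frac_eq_eq)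
  moreover have "edge_sum f z (z + 1) + edge_sum f (z + 1) (z + 1 + \<i>)
      - (edge_sum f z (z + \<i>) + edge_sum f (z + \<i>) (z + 1 + \<i>))
    = ((f (z + 1) - f (z + \<i>)) * (1 + \<i>) - (f (z + 1 + \<i>) - f z) * (1 - \<i>)) / 2"
    by (simp add: edge_sum_def field_simps)
  ultimately show ?thesis by simp
qed

text \<open>
  Integrate vertically from \<open>0\<close> to the row of \<open>z\<close>, then horizontally. The
  value has the right increments along the rows and on the imaginary axis by construction,
  and the relation around the cells carries the vertical increments from each column to the next.
\<close>

lemma discrete_analytic_primitive:
  assumes f: "discrete_analytic f"
  obtains F where "primitive F f"
proof -
  \<comment> \<open>the vertical integral up to \<open>\<i> k\<close>; one of the two sums is empty, depending on the sign of \<open>k\<close>\<close>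
  define V :: "int \<Rightarrow> complex" where
    "V k = (\<Sum>j\<in>{0..<k}. edge_sum f (\<i> * of_int j) (\<i> * of_int (j + 1)))
         - (\<Sum>j\<in>{k..<0}. edge_sum f (\<i> * of_int j) (\<i> * of_int (j + 1)))" for k
  define pt where "pt x k = complex_of_real (real x) + \<i> * of_int k" for x :: nat and k :: int
  define G where "G x k = V k + (\<Sum>j<x. edge_sum f (pt j k) (pt (Suc j) k))" for x k
  define F where "F z = G (nat \<lfloor>Re z\<rfloor>) \<lfloor>Im z\<rfloor>" for z
  have pt_mem: "pt x k \<in> half_lattice" for x k
    by (simp add: pt_def half_lattice_def)
  have pt_right: "pt x k + 1 = pt (Suc x) k" and pt_up: "pt x k + \<i> = pt x (k + 1)" for x k
    by (simp_all add: pt_def algebra_simps)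
  have F_pt: "F (pt x k) = G x k" for x k
    by (simp add: F_def pt_def)
  have V_step: "V (k + 1) - V k = edge_sum f (pt 0 k) (pt 0 (k + 1))" for k
  proof (cases "0 \<le> k")
    case True
    then have "{0..<k + 1} = insert k {0..<k}" "{k..<0} = {}" "{k + 1..<0} = {}" by auto
    then show ?thesis by (simp add: V_def pt_def)
  next
    case False
    then have "{k..<0} = insert k {k + 1..<0}" "{0..<k} = {}" "{0..<k + 1} = {}" by auto
    then show ?thesis by (simp add: V_def pt_def)
  qed
  have up: "G x (k + 1) - G x k = edge_sum f (pt x k) (pt x (k + 1))" for x k
  proof (induction x)
    case 0
    then show ?case using V_step by (simp add: G_def)
  next
    case (Suc x)
    have "pt x k + 1 + \<i> = pt (Suc x) (k + 1)" by (simp add: pt_right pt_up)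
    then have cell: "edge_sum f (pt x k) (pt (Suc x) k) + edge_sum f (pt (Suc x) k) (pt (Suc x) (k + 1))
        = edge_sum f (pt x k) (pt x (k + 1)) + edge_sum f (pt x (k + 1)) (pt (Suc x) (k + 1))"
      using discrete_analytic_cell[OF f pt_mem[of x k]] by (simp add: pt_right pt_up)
    have "G (Suc x) l = G x l + edge_sum f (pt x l) (pt (Suc x) l)" for l
      by (simp add: G_def)
    then have "G (Suc x) (k + 1) - G (Suc x) k = (G x (k + 1) - G x k)
        + edge_sum f (pt x (k + 1)) (pt (Suc x) (k + 1)) - edge_sum f (pt x k) (pt (Suc x) k)"
      by simp
    also have "\<dots> = edge_sum f (pt (Suc x) k) (pt (Suc x) (k + 1))"
      unfolding Suc.IH cell[symmetric] by simp
    finally show ?case .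
  qed
  have "primitive F f"
    unfolding primitive_def
  proof (intro conjI ballI)
    have "F (pt 0 0) = 0" by (simp only: F_pt) (simp add: G_def V_def)
    then show "F 0 = 0" by (simp add: pt_def)
    fix z assume "z \<in> half_lattice"
    then obtain m k where "Re z = of_int m" "Im z = of_int k" "0 \<le> m"
      by (auto simp: half_lattice_def Ints_def)
    then have z: "z = pt (nat m) k"
      by (simp add: pt_def complex_eq_iff)
    show "F (z + 1) - F z = edge_sum f z (z + 1)"
      unfolding z pt_right F_pt by (simp add: G_def)
    show "F (z + \<i>) - F z = edge_sum f z (z + \<i>)"
      unfolding z pt_up F_pt by (rule up)
  qed
  then show ?thesis by (rule that)
qed

lemma half_lattice_neighbours:
  assumes "z \<in> half_lattice" "w \<in> half_lattice" "cmod (w - z) = 1"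
  shows "w = z + 1 \<or> z = w + 1 \<or> w = z + \<i> \<or> z = w + \<i>"
proof -
  obtain a b where "Re (w - z) = of_int a" "Im (w - z) = of_int b"
    using assms(1,2) Ints_diff[of "Re w" "Re z"] Ints_diff[of "Im w" "Im z"]
    by (auto simp: half_lattice_def Ints_def)
  moreover from this have "real_of_int (a\<^sup>2 + b\<^sup>2) = 1"
    using assms(3) by (simp add: cmod_def)
  then have "a\<^sup>2 + b\<^sup>2 = 1" using of_int_eq_1_iff by blast
  moreover have "a\<^sup>2 + b\<^sup>2 = 1 \<Longrightarrow> (a = 0 \<and> (b = 1 \<or> b = -1)) \<or> (b = 0 \<and> (a = 1 \<or> a = -1))"
  proof -
    assume ab: "a\<^sup>2 + b\<^sup>2 = 1"
    show ?thesis
    proof (cases "a = 0")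
      case True
      then show ?thesis using ab by (simp add: power2_eq_1_iff)
    next
      case False
      then have "a\<^sup>2 > 0" by simp
      moreover have "b\<^sup>2 \<ge> 0" by simp
      ultimately have "b\<^sup>2 = 0" "a\<^sup>2 = 1" using ab by linarith+
      then show ?thesis by (simp add: power2_eq_1_iff)
    qed
  qed
  ultimately show ?thesis by (auto simp: complex_eq_iff)
qed

lemma primitive_edge:
  assumes "primitive F f" "z \<in> half_lattice" "w \<in> half_lattice" "cmod (w - z) = 1"
  shows "edge_sum f z w = F w - F z"
  using half_lattice_neighbours[OF assms(2-4)]
proof (elim disjE)
  assume "z = w + 1"
  then have "F z - F w = edge_sum f w z" using assms(1,3) by (simp add: primitive_def)
  then show ?thesis by (simp add: edge_sum_swap[of f z w] algebra_simps)
next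
  assume "z = w + \<i>"
  then have "F z - F w = edge_sum f w z" using assms(1,3) by (simp add: primitive_def)
  then show ?thesis by (simp add: edge_sum_swap[of f z w] algebra_simps)
qed (use assms(1,2) in \<open>simp_all add: primitive_def\<close>)

lemma path_sum_primitive:
  assumes "primitive F f" "half_path a b p"
  shows "path_sum p f = F b - F a"
proof -
  have p: "p \<noteq> []" "hd p = a" "last p = b" "set p \<subseteq> half_lattice"
    "\<And>k. Suc k < length p \<Longrightarrow> cmod (p ! Suc k - p ! k) = 1"
    using assms(2) by (auto simp: half_path_def)
  have "path_sum p f = (\<Sum>k<length p - 1. F (p ! Suc k) - F (p ! k))"
    unfolding path_sum_def
  proof (rule sum.cong)
    fix k assume "k \<in> {..<length p - 1}"
    then have k: "Suc k < length p" by auto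
    then have "p ! k \<in> half_lattice" "p ! Suc k \<in> half_lattice" using p(4) by auto
    from primitive_edge[OF assms(1) this p(5)[OF k]]
    show "(f (p ! k) + f (p ! Suc k)) / 2 * (p ! Suc k - p ! k) = F (p ! Suc k) - F (p ! k)"
      by (simp add: edge_sum_def)
  qed simp
  also have "\<dots> = F (p ! (length p - 1)) - F (p ! 0)"
    by (rule sum_lessThan_telescope)
  also have "\<dots> = F b - F a"
    using p(1-3) by (simp add: hd_conv_nth last_conv_nth)
  finally show ?thesis .
qed

lemma half_path_snoc:
  assumes "half_path a b p" "c \<in> half_lattice" "cmod (c - b) = 1"
  shows "half_path a c (p @ [c])"
proof -
  have "cmod ((p @ [c]) ! Suc k - (p @ [c]) ! k) = 1" if "Suc k < length (p @ [c])" for k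
  proof (cases "Suc k < length p")
    case True
    then show ?thesis using assms(1) by (simp add: half_path_def nth_append)
  next
    case False
    then have k: "k = length p - 1" "k < length p" "Suc k = length p"
      using that assms(1) by (auto simp: half_path_def)
    moreover have "p ! k = b"
      using assms(1) k by (auto simp: half_path_def last_conv_nth)
    ultimately show ?thesis using assms(3) by (simp add: nth_append)
  qed
  then show ?thesis
    using assms(1,2) by (auto simp: half_path_def)
qed

lemma half_path_exists:
  assumes "z \<in> half_lattice"
  shows "\<exists>p. half_path 0 z p"
  using assms
proof (induction rule: half_lattice_induct)
  case zero
  have "half_path 0 0 [0]" by (simp add: half_path_def)
  then show ?case by blast
next
  case (right z)
  then show ?case using half_path_snoc[of 0 z _ "z + 1"] by fastforce
next
  case (up z)
  then show ?case using half_path_snoc[of 0 z _ "z + \<i>"] by fastforce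
next
  case (down z)
  then show ?case using half_path_snoc[of 0 "z + \<i>" _ z] by fastforce
qed

lemma discrete_integral_primitive:
  assumes "primitive F f" "z \<in> half_lattice"
  shows "discrete_integral 0 z f = F z"
  unfolding discrete_integral_def
proof (rule the_equality)
  have F0: "F 0 = 0" using assms(1) by (simp add: primitive_def)
  then show "\<forall>p. half_path 0 z p \<longrightarrow> path_sum p f = F z"
    using path_sum_primitive[OF assms(1)] by simp
  fix c assume "\<forall>p. half_path 0 z p \<longrightarrow> path_sum p f = c"
  then show "c = F z"
    using half_path_exists[OF assms(2)] path_sum_primitive[OF assms(1), of 0 z] F0 by auto
qed

section \<open>The operator Z by its increments\<close>

text \<open>
  A description of \<open>g = Z f\<close> by its increments. It is linear and local, hence stable under
  pointwise convergent series, and it determines \<open>g\<close>.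
\<close>

definition Z_recurrence :: "(complex \<Rightarrow> complex) \<Rightarrow> (complex \<Rightarrow> complex) \<Rightarrow> bool" where
  "Z_recurrence f g \<longleftrightarrow> half_fun g \<and> g 0 = 0 \<and>
     (\<forall>z\<in>half_lattice. g (z + 1) = g z + f z \<and>
        g (z + \<i>) = g z + ((1 + \<i>) * f z + (\<i> - 1) * f (z + \<i>)) / 2)"

lemma Z_recurrence_Zop:
  assumes "discrete_analytic f"
  shows "Z_recurrence f (Zop f)"
proof -
  obtain F where F: "primitive F f" by (rule discrete_analytic_primitive[OF assms])
  have Z: "Zop f z = (f 0 - f z) / 2 + F z" if "z \<in> half_lattice" for z
    using that by (simp add: Zop_def discrete_integral_primitive[OF F])
  have "half_fun (Zop f)" by (simp add: half_fun_def Zop_def)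
  moreover have "Zop f 0 = 0" using Z[of 0] F by (simp add: primitive_def)
  moreover have "Zop f (z + 1) = Zop f z + f z" if z: "z \<in> half_lattice" for z
  proof -
    have d: "F (z + 1) - F z = edge_sum f z (z + 1)"
      using F z by (simp add: primitive_def)
    have "F (z + 1) = F z + edge_sum f z (z + 1)"
      unfolding d[symmetric] by simp
    then show ?thesis
      unfolding Z[OF z] Z[OF half_lattice_right[OF z]] by (simp add: edge_sum_def field_simps)
  qed
  moreover have "Zop f (z + \<i>) = Zop f z + ((1 + \<i>) * f z + (\<i> - 1) * f (z + \<i>)) / 2"
    if z: "z \<in> half_lattice" for z
  proof -
    have d: "F (z + \<i>) - F z = edge_sum f z (z + \<i>)"
      using F z by (simp add: primitive_def)
    have "F (z + \<i>) = F z + edge_sum f z (z + \<i>)"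
      unfolding d[symmetric] by simp
    then show ?thesis
      unfolding Z[OF z] Z[OF half_lattice_up_iff[THEN iffD2, OF z]] by (simp add: edge_sum_def field_simps)
  qed
  ultimately show ?thesis by (simp add: Z_recurrence_def)
qed

lemma Z_recurrence_unique:
  assumes "Z_recurrence f g" "Z_recurrence f h"
  shows "g = h"
proof
  fix z
  show "g z = h z"
  proof (cases "z \<in> half_lattice")
    case True
    then show ?thesis
      by (induction rule: half_lattice_induct) (use assms in \<open>auto simp: Z_recurrence_def\<close>)
  qed (use assms in \<open>simp add: Z_recurrence_def half_fun_def\<close>)
qed

text \<open>
  With \<open>h = (f(z) + f(z + \<i>)) / 2\<close>, the increments of \<open>g\<close> along the two diagonals of a cell are
  \<open>(1 + \<i>) h\<close> and \<open>(1 - \<i>) h\<close>.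
\<close>

lemma discrete_analytic_Z_recurrence:
  assumes "Z_recurrence f g"
  shows "discrete_analytic g"
  unfolding discrete_analytic_def
proof
  fix z assume z: "z \<in> half_lattice"
  have "g (z + \<i> + 1) = g (z + \<i>) + f (z + \<i>)" "g (z + 1) = g z + f z"
    "g (z + \<i>) = g z + ((1 + \<i>) * f z + (\<i> - 1) * f (z + \<i>)) / 2"
    using assms z by (simp_all add: Z_recurrence_def)
  moreover have "z + \<i> + 1 = z + 1 + \<i>" by simp
  ultimately have eqs: "g (z + 1 + \<i>) - g z = (1 + \<i>) * ((f z + f (z + \<i>)) / 2)"
    "g (z + 1) - g (z + \<i>) = (1 - \<i>) * ((f z + f (z + \<i>)) / 2)"
    by (simp_all add: field_simps)
  have "1 + \<i> \<noteq> 0" "1 - \<i> \<noteq> 0"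
    by (simp_all add: complex_eq_iff)
  then show "(g (z + 1 + \<i>) - g z) / (1 + \<i>) = (g (z + 1) - g (z + \<i>)) / (1 - \<i>)"
    unfolding eqs by (metis nonzero_mult_div_cancel_left)
qed

lemma discrete_analytic_one: "discrete_analytic (indicator half_lattice)"
proof -
  have "z + 1 + \<i> \<in> half_lattice" if "z \<in> half_lattice" for z
    using that by simp
  then show ?thesis by (simp add: discrete_analytic_def indicator_def)
qed

lemma discrete_analytic_dpow: "discrete_analytic (dpow n)"
  by (induction n)
     (auto simp: dpow_def discrete_analytic_one intro: discrete_analytic_Z_recurrence Z_recurrence_Zop)

lemma Z_recurrence_dpow: "Z_recurrence (dpow n) (dpow (Suc n))"
  using Z_recurrence_Zop[OF discrete_analytic_dpow[of n]] by (simp add: dpow_def)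

section \<open>The discrete powers\<close>

lemma dpow_0 [simp]: "z \<in> half_lattice \<Longrightarrow> dpow 0 z = 1"
  by (simp add: dpow_def)

lemma dpow_Suc_right:
  "z \<in> half_lattice \<Longrightarrow> dpow (Suc n) (z + 1) = dpow (Suc n) z + dpow n z"
  and dpow_Suc_up:
  "z \<in> half_lattice \<Longrightarrow> dpow (Suc n) (z + \<i>)
     = dpow (Suc n) z + ((1 + \<i>) * dpow n z + (\<i> - 1) * dpow n (z + \<i>)) / 2"
  and dpow_Suc_zero: "dpow (Suc n) 0 = 0"
  using Z_recurrence_dpow[of n] by (auto simp: Z_recurrence_def)

lemma of_nat_half_lattice [simp]: "of_nat k \<in> half_lattice"
  by (simp add: half_lattice_def)

lemma dpow_of_nat: "dpow n (of_nat k) = of_nat (k choose n)"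
proof (induction k arbitrary: n)
  case 0
  then show ?case by (cases n) (simp_all add: dpow_Suc_zero)
next
  case (Suc k)
  show ?case
  proof (cases n)
    case 0
    then show ?thesis using dpow_0[OF of_nat_half_lattice[of "Suc k"]] by simp
  next
    case (Suc m)
    then show ?thesis
      using dpow_Suc_right[OF of_nat_half_lattice[of k], of m] Suc.IH by (simp add: add.commute)
  qed
qed

text \<open>
  The partial sums \<open>s\<close> of \<open>\<bar>a\<^sub>n\<bar>\<close> satisfy \<open>s \<le> \<bar>a\<^sub>0\<bar> + \<bar>q\<bar> s + \<Sum>n. \<bar>b\<^sub>n\<bar>\<close>.
\<close>

lemma abs_summable_contracting_recurrence:
  fixes a b :: "nat \<Rightarrow> complex"
  assumes rec: "\<And>n. a (Suc n) = q * a n + b n" and q: "cmod q < 1"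
    and b: "summable (\<lambda>n. cmod (b n))"
  shows "summable (\<lambda>n. cmod (a n))"
proof (rule summableI_nonneg_bounded)
  fix N
  have "(\<Sum>n<N. cmod (a n)) \<le> (\<Sum>n<Suc N. cmod (a n))" by simp
  also have "\<dots> = cmod (a 0) + (\<Sum>n<N. cmod (a (Suc n)))"
    by (rule sum.lessThan_Suc_shift)
  also have "\<dots> \<le> cmod (a 0) + (\<Sum>n<N. cmod q * cmod (a n) + cmod (b n))"
    unfolding rec by (intro add_left_mono sum_mono order_trans[OF norm_triangle_ineq]) (simp add: norm_mult)
  also have "\<dots> \<le> cmod (a 0) + cmod q * (\<Sum>n<N. cmod (a n)) + (\<Sum>n. cmod (b n))"
    using sum_le_suminf[OF b, of "{..<N}"] by (simp add: sum.distrib sum_distrib_left)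
  finally have "(1 - cmod q) * (\<Sum>n<N. cmod (a n)) \<le> cmod (a 0) + (\<Sum>n. cmod (b n))"
    by (simp add: algebra_simps)
  then show "(\<Sum>n<N. cmod (a n)) \<le> (cmod (a 0) + (\<Sum>n. cmod (b n))) / (1 - cmod q)"
    using q by (simp add: field_simps)
qed simp

lemma abs_summable_Suc_add_scaled:
  fixes a b :: "nat \<Rightarrow> complex"
  assumes "summable (\<lambda>n. cmod (a n))"
  shows "summable (\<lambda>n. cmod (a (Suc n) + k * a n))"
proof (rule summable_comparison_test')
  show "summable (\<lambda>n. cmod (a (Suc n)) + cmod k * cmod (a n))"
    using assms summable_Suc_iff[of "\<lambda>n. cmod (a n)"] by (intro summable_add summable_mult) simp_all
  show "norm (cmod (a (Suc n) + k * a n)) \<le> cmod (a (Suc n)) + cmod k * cmod (a n)" for n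
    using norm_triangle_ineq[of "a (Suc n)" "k * a n"] by (simp add: norm_mult)
qed

text \<open>
  One lattice step at a time from \<open>0\<close>. A horizontal step expresses the new values by the old ones.
  A vertical step gives a recurrence in \<open>n\<close> for the new values, with factor \<open>(\<i> - 1) / 2\<close>
  upwards and \<open>- (1 + \<i>) / 2\<close> downwards, both of modulus \<open>1 / \<surd>2 < 1\<close>.
\<close>

lemma dpow_abs_summable:
  assumes "z \<in> half_lattice"
  shows "summable (\<lambda>n. cmod (dpow n z))"
  using assms
proof (induction rule: half_lattice_induct)
  case zero
  have "summable (\<lambda>n. cmod (dpow (Suc n) 0))" by (simp add: dpow_Suc_zero)
  then show ?case by (simp add: summable_Suc_iff[of "\<lambda>n. cmod (dpow n 0)"])
next
  case (right z)
  have "summable (\<lambda>n. cmod (dpow (Suc n) z + 1 * dpow n z))"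
    by (rule abs_summable_Suc_add_scaled[OF right(2)])
  then have "summable (\<lambda>n. cmod (dpow (Suc n) (z + 1)))"
    by (simp add: dpow_Suc_right[OF right(1)])
  then show ?case by (simp add: summable_Suc_iff[of "\<lambda>n. cmod (dpow n (z + 1))"])
next
  case (up z)
  have q: "cmod ((\<i> - 1) / 2) < 1"
    by (simp add: cmod_def power_divide real_sqrt_divide)
  have rec: "dpow (Suc n) (z + \<i>) = (\<i> - 1) / 2 * dpow n (z + \<i>)
      + (dpow (Suc n) z + (1 + \<i>) / 2 * dpow n z)" for n
    unfolding dpow_Suc_up[OF up(1)] by (simp add: field_simps)
  show ?case
    by (rule abs_summable_contracting_recurrence[OF rec q abs_summable_Suc_add_scaled[OF up(2)]])
next
  case (down z)
  have q: "cmod (- (1 + \<i>) / 2) < 1"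
    by (simp add: cmod_def power_divide real_sqrt_divide)
  have rec: "dpow (Suc n) z = - (1 + \<i>) / 2 * dpow n z
      + (dpow (Suc n) (z + \<i>) + (1 - \<i>) / 2 * dpow n (z + \<i>))" for n
    unfolding dpow_Suc_up[OF down(1)] by (simp add: field_simps)
  show ?case
    by (rule abs_summable_contracting_recurrence[OF rec q abs_summable_Suc_add_scaled[OF down(2)]])
qed

section \<open>Series of discrete powers\<close>

text \<open>
  Series with bounded coefficients are allowed, and not only square summable ones, because
  the Cauchy product of two square summable sequences is bounded but need not be square summable.
\<close>

definition dpow_series :: "(nat \<Rightarrow> complex) \<Rightarrow> complex \<Rightarrow> complex" where
  "dpow_series a z = (if z \<in> half_lattice then \<Sum>n. a n * dpow n z else 0)"

lemma dpow_series_sums: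
  assumes "Bseq a" "z \<in> half_lattice"
  shows "(\<lambda>n. a n * dpow n z) sums dpow_series a z"
proof -
  obtain K where K: "\<And>n. cmod (a n) \<le> K"
    using assms(1) by (auto simp: Bseq_def)
  have "summable (\<lambda>n. a n * dpow n z)"
  proof (rule summable_comparison_test')
    show "summable (\<lambda>n. K * cmod (dpow n z))"
      by (intro summable_mult dpow_abs_summable assms)
    show "norm (a n * dpow n z) \<le> K * cmod (dpow n z)" for n
      using K by (simp add: norm_mult mult_right_mono)
  qed
  then show ?thesis
    using assms(2) by (simp add: dpow_series_def summable_sums)
qed

lemma discrete_analytic_dpow_series:
  assumes "Bseq a"
  shows "discrete_analytic (dpow_series a)"
  unfolding discrete_analytic_def
proof
  fix z assume z: "z \<in> half_lattice"
  note S = dpow_series_sums[OF assms]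
  have mem: "z + 1 \<in> half_lattice" "z + \<i> \<in> half_lattice" "z + 1 + \<i> \<in> half_lattice"
    using z by simp_all
  have "(\<lambda>n. (a n * dpow n (z + 1 + \<i>) - a n * dpow n z) / (1 + \<i>))
      sums ((dpow_series a (z + 1 + \<i>) - dpow_series a z) / (1 + \<i>))"
    by (intro sums_divide sums_diff S z mem)
  moreover have "(\<lambda>n. (a n * dpow n (z + 1) - a n * dpow n (z + \<i>)) / (1 - \<i>))
      sums ((dpow_series a (z + 1) - dpow_series a (z + \<i>)) / (1 - \<i>))"
    by (intro sums_divide sums_diff S mem)
  moreover have "(a n * dpow n (z + 1 + \<i>) - a n * dpow n z) / (1 + \<i>)
      = (a n * dpow n (z + 1) - a n * dpow n (z + \<i>)) / (1 - \<i>)" for n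
    using discrete_analytic_dpow[of n] z
    by (simp add: discrete_analytic_def flip: right_diff_distrib times_divide_eq_right)
  ultimately show "(dpow_series a (z + 1 + \<i>) - dpow_series a z) / (1 + \<i>)
      = (dpow_series a (z + 1) - dpow_series a (z + \<i>)) / (1 - \<i>)"
    by (simp add: sums_unique2)
qed

lemma Bseq_case_nat: "Bseq a \<Longrightarrow> Bseq (case_nat (0 :: complex) a)"
  by (subst Bseq_Suc_iff[symmetric]) simp

text \<open>
  The shifted series satisfies the increments that characterise \<open>Z\<close>, because each \<open>dpow (Suc n)\<close>
  satisfies them relative to \<open>dpow n\<close>.
\<close>

lemma Zop_dpow_series:
  assumes "Bseq a"
  shows "Zop (dpow_series a) = dpow_series (case_nat 0 a)"
proof (rule Z_recurrence_unique[OF Z_recurrence_Zop[OF discrete_analytic_dpow_series[OF assms]]])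
  let ?g = "dpow_series (case_nat 0 a)"
  have g: "(\<lambda>n. a n * dpow (Suc n) z) sums ?g z" if "z \<in> half_lattice" for z
    using dpow_series_sums[OF Bseq_case_nat[OF assms] that]
      sums_Suc_iff[of "\<lambda>n. case_nat 0 a n * dpow n z" "?g z"] by simp
  note f = dpow_series_sums[OF assms]
  have "half_fun ?g" by (simp add: half_fun_def dpow_series_def)
  moreover have "?g 0 = 0"
    using g[of 0] by (simp add: dpow_Suc_zero sums_iff)
  moreover have "?g (z + 1) = ?g z + dpow_series a z" if z: "z \<in> half_lattice" for z
  proof (rule sums_unique2[OF g])
    show "(\<lambda>n. a n * dpow (Suc n) (z + 1)) sums (?g z + dpow_series a z)"
      using sums_add[OF g f] z by (simp add: dpow_Suc_right distrib_left)
  qed (use z in simp)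
  moreover have "?g (z + \<i>) = ?g z
      + ((1 + \<i>) * dpow_series a z + (\<i> - 1) * dpow_series a (z + \<i>)) / 2"
    if z: "z \<in> half_lattice" for z
  proof (rule sums_unique2[OF g])
    have "(\<lambda>n. a n * dpow (Suc n) z
        + ((1 + \<i>) * (a n * dpow n z) + (\<i> - 1) * (a n * dpow n (z + \<i>))) / 2)
      sums (?g z + ((1 + \<i>) * dpow_series a z + (\<i> - 1) * dpow_series a (z + \<i>)) / 2)"
      using z by (intro sums_add sums_divide sums_mult g f) auto
    then show "(\<lambda>n. a n * dpow (Suc n) (z + \<i>))
      sums (?g z + ((1 + \<i>) * dpow_series a z + (\<i> - 1) * dpow_series a (z + \<i>)) / 2)"
      unfolding dpow_Suc_up[OF z] by (simp add: field_simps)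
  qed (use z in simp)
  ultimately show "Z_recurrence (dpow_series a) ?g"
    by (simp add: Z_recurrence_def)
qed

text \<open>
  At a natural number \<open>k\<close> the terms beyond the \<open>k\<close>-th vanish and the \<open>k\<close>-th
  coefficient is multiplied by \<open>1\<close>, so the values on the natural numbers give a triangular
  system for the coefficients.
\<close>

lemma dpow_expansion_unique:
  assumes a: "\<And>k. (\<lambda>n. a n * dpow n (of_nat k)) sums f k"
    and b: "\<And>k. (\<lambda>n. b n * dpow n (of_nat k)) sums f k"
  shows "a = b"
proof
  fix n
  show "a n = b n"
  proof (induction n rule: less_induct)
    case (less n)
    have fin: "(\<Sum>m\<le>n. c m * of_nat (n choose m)) = f n"
      if "(\<lambda>m. c m * dpow m (of_nat n)) sums f n" for c
      using that by (intro sums_unique2[OF sums_finite[of "{..n}"]]) (auto simp: dpow_of_nat)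
    have "(\<Sum>m<n. a m * of_nat (n choose m)) + a n = (\<Sum>m<n. b m * of_nat (n choose m)) + b n"
      using fin[OF a] fin[OF b] by (simp add: lessThan_Suc_atMost[symmetric])
    moreover have "(\<Sum>m<n. a m * of_nat (n choose m)) = (\<Sum>m<n. b m * of_nat (n choose m))"
      using less by (intro sum.cong) auto
    ultimately show ?case by simp
  qed
qed

section \<open>The Hardy space as a sequence space\<close>

definition h2_fun :: "ell2 \<Rightarrow> complex \<Rightarrow> complex" where
  "h2_fun a = dpow_series (coef a)"

lemma Bseq_coef: "Bseq (coef a)"
  by (rule BseqI'[OF norm_coef_le])

lemma h2_fun_sums: "z \<in> half_lattice \<Longrightarrow> (\<lambda>n. coef a n * dpow n z) sums h2_fun a z"
  unfolding h2_fun_def by (rule dpow_series_sums[OF Bseq_coef])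

lemma half_fun_h2_fun: "half_fun (h2_fun a)"
  by (simp add: half_fun_def h2_fun_def dpow_series_def)

lemma h2_expansion_h2_fun: "h2_expansion (h2_fun a) c \<longleftrightarrow> c = coef a"
proof
  assume "h2_expansion (h2_fun a) c"
  then have "(\<lambda>n. c n * dpow n (of_nat k)) sums h2_fun a (of_nat k)" for k
    by (simp add: h2_expansion_def)
  then show "c = coef a"
    using h2_fun_sums[OF of_nat_half_lattice] by (rule dpow_expansion_unique)
qed (simp add: h2_expansion_def h2_fun_sums coef_square_summable)

lemma h2_fun_H2 [simp]: "h2_fun a \<in> H2"
  using h2_expansion_h2_fun[of a "coef a"] by (auto simp: H2_def half_fun_h2_fun)

lemma H2_eq_range: "H2 = range h2_fun"
proof
  show "H2 \<subseteq> range h2_fun"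
  proof
    fix f assume "f \<in> H2"
    then obtain c where f: "half_fun f" and c: "h2_expansion f c" by (auto simp: H2_def)
    then have "coef (Ell2 c) = c" by (simp add: h2_expansion_def coef_Ell2)
    then have "f z = h2_fun (Ell2 c) z" for z
      using c f sums_unique2[OF h2_fun_sums[of z "Ell2 c"], of "f z"] half_fun_h2_fun[of "Ell2 c"]
      by (cases "z \<in> half_lattice") (auto simp: h2_expansion_def half_fun_def)
    then show "f \<in> range h2_fun" by blast
  qed
qed auto

lemma h2_coeff_h2_fun [simp]: "h2_coeff (h2_fun a) = coef a"
proof -
  have "(THE c. h2_expansion (h2_fun a) c) = coef a"
    by (rule the_equality) (simp_all add: h2_expansion_h2_fun)
  then show ?thesis by (simp add: h2_coeff_def fun_eq_iff)
qed

lemma inj_h2_fun: "inj h2_fun"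
  by (rule injI) (metis h2_coeff_h2_fun coef_inject)

lemma h2_norm_h2_fun [simp]: "h2_norm (h2_fun a) = norm a"
  by (simp add: h2_norm_def h2_inner_def cinner_self flip: cinner_def)

lemma h2_fun_add: "h2_fun (a + b) z = h2_fun a z + h2_fun b z"
proof (cases "z \<in> half_lattice")
  case True
  from sums_add[OF h2_fun_sums[OF this, of a] h2_fun_sums[OF this, of b]] h2_fun_sums[OF this, of "a + b"]
  show ?thesis by (auto simp: distrib_right intro: sums_unique2)
qed (simp add: h2_fun_def dpow_series_def)

lemma h2_fun_cscale: "h2_fun (cscale k a) z = k * h2_fun a z"
proof (cases "z \<in> half_lattice")
  case True
  from sums_mult[OF h2_fun_sums[OF this, of a], of k] h2_fun_sums[OF this, of "cscale k a"]
  show ?thesis by (auto simp: mult.assoc intro: sums_unique2)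
qed (simp add: h2_fun_def dpow_series_def)

lemma h2_fun_diff: "h2_fun (a - b) z = h2_fun a z - h2_fun b z"
  using h2_fun_add[of "a - b" b z] by simp

lemma h2_fun_0: "h2_fun 0 = 0"
  using h2_fun_diff[of 0 0] by (auto simp: fun_eq_iff)

lemma h2_dist_h2_fun: "h2_dist (h2_fun a) (h2_fun b) = dist a b"
proof -
  have "(\<lambda>z. h2_fun a z - h2_fun b z) = h2_fun (a - b)"
    by (simp add: h2_fun_diff fun_eq_iff)
  then show ?thesis by (simp add: h2_dist_def dist_norm)
qed

lemma Zop_h2_fun: "Zop (h2_fun a) = h2_fun (shift a)"
  unfolding h2_fun_def by (simp add: Zop_dpow_series[OF Bseq_coef] shift.rep_eq[abs_def])

lemma Zop_power_h2_fun: "(Zop ^^ n) (h2_fun a) = h2_fun ((shift ^^ n) a)"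
  by (induction n) (simp_all add: Zop_h2_fun)

lemma h2_coeff_outside: "f \<notin> H2 \<Longrightarrow> h2_coeff f n = 0"
  by (simp add: h2_coeff_def)

lemma h2_coeff_eq_coef: "\<exists>a. h2_coeff f = coef a"
proof (cases "f \<in> H2")
  case True
  then show ?thesis by (auto simp: H2_eq_range)
next
  case False
  then have "h2_coeff f = coef 0" by (simp add: h2_coeff_outside fun_eq_iff)
  then show ?thesis by blast
qed

text \<open>
  Here and in the next lemma \<open>f\<close> is arbitrary, because a metric must be non-negative and symmetric at
  all arguments, also where the difference lies outside \<open>H2\<close>.
\<close>

lemma h2_norm_eq_norm:
  obtains a where "h2_coeff f = coef a" "h2_norm f = norm a"
proof -
  obtain a where a: "h2_coeff f = coef a" using h2_coeff_eq_coef by blast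
  then have "h2_norm f = h2_norm (h2_fun a)" by (simp add: h2_norm_def h2_inner_def)
  with a show ?thesis by (intro that) auto
qed

lemma h2_norm_uminus: "h2_norm (\<lambda>z. - f z) = h2_norm f"
proof -
  have minus: "(\<lambda>z. - h2_fun a z) = h2_fun (- a)" for a
    using h2_fun_diff[of 0 a] by (auto simp: fun_eq_iff h2_fun_0)
  show ?thesis
  proof (cases "f \<in> H2")
    case True
    then show ?thesis by (auto simp: H2_eq_range minus)
  next
    case False
    have "(\<lambda>z. - f z) \<notin> H2"
    proof
      assume "(\<lambda>z. - f z) \<in> H2"
      then obtain a where a: "(\<lambda>z. - f z) = h2_fun a" by (auto simp: H2_eq_range)
      have "f = h2_fun (- a)"
        unfolding minus[symmetric] a[symmetric] by simp
      with False show False by simp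
    qed
    with False show ?thesis by (simp add: h2_norm_def h2_inner_def h2_coeff_outside)
  qed
qed

lemma Metric_space_H2: "Metric_space H2 h2_dist"
proof
  fix f g
  show "0 \<le> h2_dist f g"
    unfolding h2_dist_def by (rule h2_norm_eq_norm[of "\<lambda>z. f z - g z"]) simp
  show "h2_dist f g = h2_dist g f"
    using h2_norm_uminus[of "\<lambda>z. f z - g z"] by (simp add: h2_dist_def)
next
  fix f g assume "f \<in> H2" "g \<in> H2"
  then show "h2_dist f g = 0 \<longleftrightarrow> f = g"
    using inj_h2_fun by (auto simp: H2_eq_range h2_dist_h2_fun inj_eq)
next
  fix f g h assume "f \<in> H2" "g \<in> H2" "h \<in> H2"
  then show "h2_dist f h \<le> h2_dist f g + h2_dist g h"
    by (auto simp: H2_eq_range h2_dist_h2_fun dist_triangle)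
qed

lemma module_fun: "module (\<lambda>c (f :: complex \<Rightarrow> complex) z. c * f z)"
  by standard (auto simp: fun_eq_iff algebra_simps)

lemma closed_subspace_H2_preimage:
  assumes "closed_subspace_H2 H"
  shows "csubspace (h2_fun -` H)" "closed (h2_fun -` H)" "H = h2_fun ` (h2_fun -` H)"
proof -
  interpret Metric_space H2 h2_dist by (rule Metric_space_H2)
  have sub: "H \<subseteq> H2" and clo: "closedin mtopology H"
    using assms by (auto simp: closed_subspace_H2_def)
  have H: "0 \<in> H" "\<And>f g. f \<in> H \<Longrightarrow> g \<in> H \<Longrightarrow> f + g \<in> H"
    "\<And>c f. f \<in> H \<Longrightarrow> (\<lambda>z. c * f z) \<in> H"
    using assms by (auto simp: closed_subspace_H2_def module.subspace_def[OF module_fun])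
  have "h2_fun (a + b) = h2_fun a + h2_fun b" "h2_fun (cscale k a) = (\<lambda>z. k * h2_fun a z)" for a b k
    by (auto simp: h2_fun_add h2_fun_cscale fun_eq_iff)
  then show "csubspace (h2_fun -` H)"
    using H by (simp add: csubspace_def h2_fun_0)
  show "closed (h2_fun -` H)"
    unfolding closed_sequential_limits
  proof (intro allI impI, elim conjE)
    fix X l assume X: "\<forall>n. X n \<in> h2_fun -` H" "X \<longlonglongrightarrow> l"
    have "limitin mtopology (\<lambda>n. h2_fun (X n)) (h2_fun l) sequentially"
      using iffD1[OF tendsto_dist_iff X(2)] by (simp add: limitin_metric_dist_null h2_dist_h2_fun)
    moreover have "range (\<lambda>n. h2_fun (X n)) \<subseteq> H" using X(1) by auto
    ultimately have "h2_fun l \<in> H"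
      using clo unfolding metric_closedin_iff_sequentially_closed by blast
    then show "l \<in> h2_fun -` H" by simp
  qed
  show "H = h2_fun ` (h2_fun -` H)"
    using sub by (auto simp: H2_eq_range)
qed

section \<open>Shift-orthonormal sequences give Schur functions\<close>

text \<open>
  The vector that represents evaluation at \<open>z\<close>, see \<open>h2_fun_eq_cinner\<close>.
\<close>

definition point_vector :: "complex \<Rightarrow> ell2" where
  "point_vector z = Ell2 (\<lambda>n. cnj (dpow n z))"

lemma dpow_square_summable:
  assumes "z \<in> half_lattice"
  shows "summable (\<lambda>n. (cmod (dpow n z))\<^sup>2)"
proof -
  note s = dpow_abs_summable[OF assms]
  obtain K where K: "\<And>n. cmod (dpow n z) \<le> K"
    using convergent_imp_Bseq[OF convergentI[OF summable_LIMSEQ_zero[OF s]]] by (auto simp: Bseq_def)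
  show ?thesis
  proof (rule summable_comparison_test')
    show "summable (\<lambda>n. K * cmod (dpow n z))" by (rule summable_mult[OF s])
    show "norm ((cmod (dpow n z))\<^sup>2) \<le> K * cmod (dpow n z)" for n
      using K[of n] by (simp add: power2_eq_square mult_right_mono)
  qed
qed

lemma coef_point_vector: "z \<in> half_lattice \<Longrightarrow> coef (point_vector z) n = cnj (dpow n z)"
  unfolding point_vector_def by (subst coef_Ell2) (simp_all add: dpow_square_summable)

lemma h2_fun_eq_cinner: "z \<in> half_lattice \<Longrightarrow> h2_fun a z = cinner a (point_vector z)"
  using h2_fun_sums[of z a] cinner_sums[of a "point_vector z"]
  by (simp add: coef_point_vector sums_unique2)

lemma bessel_shift:
  assumes "shift_orthonormal b"
  shows "summable (\<lambda>n. (cmod (cinner ((shift ^^ n) b) x))\<^sup>2)"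
    and "(\<Sum>n. (cmod (cinner ((shift ^^ n) b) x))\<^sup>2) \<le> (norm x)\<^sup>2"
proof -
  have "cmod (cinner ((shift ^^ n) b) x) = cmod (cinner x ((shift ^^ n) b))" for n
    by (subst cinner_cnj) simp
  then have le: "(\<Sum>n<N. (cmod (cinner ((shift ^^ n) b) x))\<^sup>2) \<le> (norm x)\<^sup>2" for N
    using bessel[of "{..<N}" "\<lambda>n. (shift ^^ n) b" x] assms by (simp add: shift_orthonormal_def)
  then show s: "summable (\<lambda>n. (cmod (cinner ((shift ^^ n) b) x))\<^sup>2)"
    by (intro summableI_nonneg_bounded[where x = "(norm x)\<^sup>2"]) auto
  show "(\<Sum>n. (cmod (cinner ((shift ^^ n) b) x))\<^sup>2) \<le> (norm x)\<^sup>2"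
    by (rule suminf_le_const[OF s le])
qed

lemma norm_square_double_sum:
  fixes x :: "nat \<Rightarrow> complex"
  shows "(\<Sum>j\<in>I. \<Sum>k\<in>I. c j * cnj (c k) * (x j * cnj (x k)))
    = complex_of_real ((cmod (\<Sum>j\<in>I. c j * x j))\<^sup>2)"
  unfolding complex_norm_square cnj_sum sum_product
  by (intro sum.cong refl) (simp add: mult_ac)

text \<open>
  With \<open>x\<close> the combination of the vectors \<open>point_vector (w j)\<close> with coefficients \<open>cnj (c j)\<close>,
  the \<open>n\<close>-th term of the quadratic form is \<open>\<bar>x\<^sub>n\<bar>\<^sup>2 - \<bar>\<langle>S\<^sup>n b, x\<rangle>\<bar>\<^sup>2\<close>. The first
  part sums to \<open>\<parallel>x\<parallel>\<^sup>2\<close>, the second to at most that.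
\<close>

lemma positive_schur_kernel:
  assumes b: "shift_orthonormal b"
  shows "positive_kernel (schur_kernel (h2_fun b))"
  unfolding positive_kernel_def
proof (intro allI impI)
  fix N :: nat and w c :: "nat \<Rightarrow> complex"
  assume "\<forall>j\<in>{1..N}. w j \<in> half_lattice"
  then have w: "\<And>j. j \<in> {1..N} \<Longrightarrow> w j \<in> half_lattice" by blast
  define v where "v n j = cinner ((shift ^^ n) b) (point_vector (w j))" for n j
  define x where "x = (\<Sum>j=1..N. cscale (cnj (c j)) (point_vector (w j)))"
  have "(\<lambda>n. dpow n (w j) * cnj (dpow n (w k)) - v n j * cnj (v n k))
      sums schur_kernel (h2_fun b) (w k) (w j)" if jk: "j \<in> {1..N}" "k \<in> {1..N}" for j k
  proof -
    have "summable (\<lambda>n. dpow n (w j) * cnj (dpow n (w k)))"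
      using w[OF jk(1)] w[OF jk(2)]
      by (intro summable_norm_cancel[OF abs_summable_mult_cnj] dpow_square_summable)
    moreover have "summable (\<lambda>n. v n j * cnj (v n k))"
      unfolding v_def by (intro summable_norm_cancel[OF abs_summable_mult_cnj] bessel_shift b)
    ultimately show ?thesis
      using jk w by (simp add: schur_kernel_def v_def Zop_power_h2_fun h2_fun_eq_cinner summable_sums summable_diff)
  qed
  then have "(\<lambda>n. \<Sum>j=1..N. \<Sum>k=1..N. c j * cnj (c k) * (dpow n (w j) * cnj (dpow n (w k)) - v n j * cnj (v n k)))
      sums (\<Sum>j=1..N. \<Sum>k=1..N. c j * cnj (c k) * schur_kernel (h2_fun b) (w k) (w j))"
    by (intro sums_sum sums_mult)
  moreover have "(\<Sum>j=1..N. \<Sum>k=1..N. c j * cnj (c k) * (dpow n (w j) * cnj (dpow n (w k)) - v n j * cnj (v n k)))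
      = complex_of_real ((cmod (coef x n))\<^sup>2 - (cmod (cinner ((shift ^^ n) b) x))\<^sup>2)" for n
  proof -
    have "cinner ((shift ^^ n) b) x = (\<Sum>j=1..N. c j * v n j)"
      by (simp add: x_def v_def cinner_sum_right cinner_cscale_right)
    moreover have "coef x n = cnj (\<Sum>j=1..N. c j * dpow n (w j))"
      using w by (simp add: x_def coef_point_vector)
    then have "cmod (coef x n) = cmod (\<Sum>j=1..N. c j * dpow n (w j))"
      by (simp only: complex_mod_cnj)
    ultimately show ?thesis
      by (simp only: right_diff_distrib sum_subtractf norm_square_double_sum of_real_diff)
  qed
  moreover have "(\<lambda>n. complex_of_real ((cmod (coef x n))\<^sup>2 - (cmod (cinner ((shift ^^ n) b) x))\<^sup>2))
      sums complex_of_real ((norm x)\<^sup>2 - (\<Sum>n. (cmod (cinner ((shift ^^ n) b) x))\<^sup>2))"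
    by (intro sums_of_real sums_diff norm_ell2_sums summable_sums bessel_shift b)
  ultimately have "(\<Sum>j=1..N. \<Sum>k=1..N. c j * cnj (c k) * schur_kernel (h2_fun b) (w k) (w j))
      = complex_of_real ((norm x)\<^sup>2 - (\<Sum>n. (cmod (cinner ((shift ^^ n) b) x))\<^sup>2))"
    using sums_unique2 by fastforce
  moreover have "0 \<le> (norm x)\<^sup>2 - (\<Sum>n. (cmod (cinner ((shift ^^ n) b) x))\<^sup>2)"
    using bessel_shift(2)[OF b, of x] by simp
  ultimately show "0 \<le> (\<Sum>j=1..N. \<Sum>k=1..N. c j * cnj (c k) * schur_kernel (h2_fun b) (w k) (w j))"
    by (simp only: less_eq_complex_def) simp
qed

lemma schur_function_h2_fun:
  assumes b: "shift_orthonormal b"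
  shows "schur_function (h2_fun b)"
  unfolding schur_function_def
proof (intro conjI ballI)
  show "half_fun (h2_fun b)" by (rule half_fun_h2_fun)
  show "discrete_analytic (h2_fun b)"
    unfolding h2_fun_def by (rule discrete_analytic_dpow_series[OF Bseq_coef])
  show "summable (\<lambda>n. (cmod ((Zop ^^ n) (h2_fun b) z))\<^sup>2)" if "z \<in> half_lattice" for z
    using bessel_shift(1)[OF b] that by (simp add: Zop_power_h2_fun h2_fun_eq_cinner)
  show "positive_kernel (schur_kernel (h2_fun b))" by (rule positive_schur_kernel[OF b])
qed

section \<open>The convolution product\<close>

definition convolution :: "(nat \<Rightarrow> complex) \<Rightarrow> (nat \<Rightarrow> complex) \<Rightarrow> nat \<Rightarrow> complex" where
  "convolution a c n = (\<Sum>m\<le>n. a m * c (n - m))"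

lemma conv_prod_eq_series: "s \<odot> f = dpow_series (convolution (h2_coeff s) (h2_coeff f))"
  by (rule ext) (simp add: conv_prod_def dpow_series_def convolution_def sum_distrib_right)

lemma conv_prod_h2_fun:
  assumes "shift_orthonormal b"
  shows "h2_fun b \<odot> h2_fun c = h2_fun (shift_series b c)"
proof -
  have "convolution (coef b) (coef c) = coef (shift_series b c)"
    by (rule ext) (simp add: convolution_def coef_shift_series[OF assms])
  then show ?thesis by (simp add: conv_prod_eq_series h2_fun_def[of "shift_series b c"])
qed

lemma Bseq_convolution: "Bseq (convolution (coef a) (coef c))"
proof (rule BseqI')
  fix n
  have le: "(\<Sum>m\<le>n. (cmod (coef e m))\<^sup>2) \<le> (norm e)\<^sup>2" for e
    using sum_le_suminf[OF coef_square_summable[of e], of "{..n}"] norm_ell2_sums[of e]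
    by (simp add: sums_iff)
  have "cmod (convolution (coef a) (coef c) n) \<le> (\<Sum>m\<le>n. cmod (coef a m) * cmod (coef c (n - m)))"
    unfolding convolution_def norm_mult[symmetric] by (rule norm_sum)
  also have "\<dots> \<le> (\<Sum>m\<le>n. (cmod (coef a m))\<^sup>2 + (cmod (coef c (n - m)))\<^sup>2)"
  proof (rule sum_mono)
    fix m
    have "2 * (cmod (coef a m) * cmod (coef c (n - m))) \<le> (cmod (coef a m))\<^sup>2 + (cmod (coef c (n - m)))\<^sup>2"
      using sum_squares_bound[of "cmod (coef a m)"] by (simp add: mult.assoc)
    moreover have "0 \<le> cmod (coef a m) * cmod (coef c (n - m))" by simp
    ultimately show "cmod (coef a m) * cmod (coef c (n - m)) \<le> (cmod (coef a m))\<^sup>2 + (cmod (coef c (n - m)))\<^sup>2"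
      by linarith
  qed
  also have "\<dots> = (\<Sum>m\<le>n. (cmod (coef a m))\<^sup>2) + (\<Sum>m\<le>n. (cmod (coef c m))\<^sup>2)"
    using sum_atMost_flip[of "\<lambda>m. (cmod (coef c m))\<^sup>2" n] by (simp add: sum.distrib)
  also have "\<dots> \<le> (norm a)\<^sup>2 + (norm c)\<^sup>2"
    by (intro add_mono le)
  finally show "cmod (convolution (coef a) (coef c) n) \<le> (norm a)\<^sup>2 + (norm c)\<^sup>2" .
qed

text \<open>
  On coefficients this is the compatibility of the Cauchy product with the shift. For
  arbitrary \<open>s\<close> the product is a bounded sequence, which is enough for \<open>Zop_dpow_series\<close>;
  if \<open>s\<close> is not in \<open>H2\<close>, its coefficients are \<open>0\<close> by convention and both sides vanish.
\<close>

lemma Zop_conv_prod: "Zop (s \<odot> h2_fun c) = s \<odot> h2_fun (shift c)"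
proof -
  obtain a where a: "h2_coeff s = coef a" using h2_coeff_eq_coef by blast
  have "case_nat 0 (convolution (coef a) (coef c)) n = convolution (coef a) (coef (shift c)) n" for n
  proof (cases n)
    case (Suc k)
    have "(\<Sum>m\<le>k. coef a m * coef (shift c) (Suc k - m)) = (\<Sum>m\<le>k. coef a m * coef c (k - m))"
      by (rule sum.cong) (auto simp: Suc_diff_le)
    then show ?thesis by (simp add: Suc convolution_def)
  qed (simp add: convolution_def)
  then have "case_nat 0 (convolution (coef a) (coef c)) = convolution (coef a) (coef (shift c))"
    by (rule ext)
  then show ?thesis
    by (simp add: conv_prod_eq_series a Zop_dpow_series[OF Bseq_convolution])
qed

section \<open>Invariant subspaces of the Hardy space\<close>

theorem theorem5p5:
  fixes H :: "(complex \<Rightarrow> complex) set"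
  assumes "closed_subspace_H2 H"
    and "H \<noteq> {0}"
  shows "Zop ` H \<subseteq> H \<longleftrightarrow>
    (\<exists>s. schur_function s \<and> isometry_on_H2 (\<lambda>f. s \<odot> f) \<and> (\<lambda>f. s \<odot> f) ` H2 = H)"
proof
  assume Z: "Zop ` H \<subseteq> H"
  define L where "L = h2_fun -` H"
  note L = closed_subspace_H2_preimage[OF assms(1), folded L_def]
  have "shift ` L \<subseteq> L"
    using Z by (auto simp: L_def simp flip: Zop_h2_fun)
  moreover have "L \<noteq> {0}"
    using assms(2) L(3) by (auto simp: h2_fun_0)
  ultimately obtain b where b: "shift_orthonormal b" and range: "L = range (shift_series b)"
    using beurling[OF L(1,2)] by blast
  have "isometry_on_H2 (\<lambda>f. h2_fun b \<odot> f)"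
    by (auto simp: isometry_on_H2_def H2_eq_range conv_prod_h2_fun[OF b] norm_shift_series[OF b])
  moreover have "(\<lambda>f. h2_fun b \<odot> f) ` H2 = H"
    unfolding H2_eq_range L(3) range image_image conv_prod_h2_fun[OF b] ..
  ultimately show "\<exists>s. schur_function s \<and> isometry_on_H2 (\<lambda>f. s \<odot> f) \<and> (\<lambda>f. s \<odot> f) ` H2 = H"
    using schur_function_h2_fun[OF b] by blast
next
  assume "\<exists>s. schur_function s \<and> isometry_on_H2 (\<lambda>f. s \<odot> f) \<and> (\<lambda>f. s \<odot> f) ` H2 = H"
  then obtain s where H: "H = (\<lambda>f. s \<odot> f) ` H2" by blast
  show "Zop ` H \<subseteq> H"
    unfolding H H2_eq_range by (auto simp: Zop_conv_prod)
qed

end
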